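(* Let $\theta$ be a non-cuspidal direction with octagon additive continued fraction expansion $\theta=[s_0;s_1,\dots,s_n,\dots]_O$. Then the entries $\{s_k\}_{k\in\mathbb{N}}$ of the expansion give the normalized cutting sequence $\bar c(r_\theta)$ of the Teichmüller geodesic ray $r_\theta$, i.e. $\bar c(r_\theta)_k=s_k$ for all $k\ge0$.
   Context: Matrices: $$\gamma=\begin{pmatrix}-1&2(1+\sqrt2)\\0&1\end{pmatrix},\quad \nu_0=\begin{pmatrix}1&0\\0&1\end{pmatrix},\ \nu_1=\tfrac1{\sqrt2}\begin{pmatrix}1&1\\1&-1\end{pmatrix},\ \nu_2=\tfrac1{\sqrt2}\begin{pmatrix}1&1\\-1&1\end{pmatrix},\ \nu_3=\begin{pmatrix}0&1\\1&0\end{pmatrix},$$ $$\nu_4=\begin{pmatrix}0&1\\-1&0\end{pmatrix},\ \nu_5=\tfrac1{\sqrt2}\begin{pmatrix}-1&1\\1&1\end{pmatrix},\ \nu_6=\tfrac1{\sqrt2}\begin{pmatrix}-1&1\\-1&-1\end{pmatrix},\ \nu_7=\begin{pmatrix}-1&0\\0&1\end{pmatrix}.$$ Octagon Farey map. A line in $\mathbb{R}^2$ (point of $\mathbb{RP}^1$) spanned by $(x,y)$ has inverse slope coordinate $u=x/y$ and angle coordinate $\theta\in[0,\pi]$, $u=\cot\theta$. A matrix $L=\begin{pmatrix}a&b\\c&d\end{pmatrix}$ acts by $L[u]=\frac{au+b}{cu+d}$. $\overline\Sigma_i$ ($0\le i\le7$) is the sector with angle coordinates $[i\pi/8,(i+1)\pi/8]$.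 The octagon Farey map $F$ is given on $\overline\Sigma_i$ by $F_i(u)=\gamma\nu_i[u]$; each $F_i$ maps $\overline\Sigma_i$ bijectively onto $\overline\Sigma=\overline\Sigma_1\cup\dots\cup\overline\Sigma_7$. For a sequence $(s_k)_{k\ge0}$ with $s_k\in\{0,\dots,7\}$ and $s_k\neq0$ for $k\ge1$, the intersection $\bigcap_{k}F_{s_0}^{-1}F_{s_1}^{-1}\cdots F_{s_k}^{-1}[0,\pi]$ (with $F_{s}^{-1}$ denoting preimage in $\overline\Sigma_s$) is a single point $\theta$, and one writes $\theta=[s_0;s_1,\dots]_O$, the octagon additive continued fraction expansion of $\theta$. Ideal octagon tessellation. The Teichmüller disk of the regular octagon surface is identified with the upper half-plane $\mathbb{H}$. A matrix $\nu=\begin{pmatrix}a&b\\c&d\end{pmatrix}$ of determinant $\pm1$ acts on the right on $\mathbb{H}$ by $z\nu=\frac{az+c}{bz+d}$ if $\det\nu=1$, and $z\nu=\frac{a\bar z+c}{b\bar z+d}$ if $\det\nu=-1$. $V_P$ is the subgroup of $PGL(2,\mathbb{R})$ generated by the images of $\alpha=\begin{pmatrix}1&0\\0&-1\end{pmatrix}$, $\beta=\nu_1$ and $\gamma$ (the projective Veech group of the octagon surface); it is the group generated by reflections in the sides of the hyperbolic triangle with vertices $\sqrt{-1},0,1-\sqrt2$, which is a strict fundamental domain. $E_0$ is the geodesic with endpoints $0$ and $1-\sqrt2$, $E_i=E_0\nu_i$, and $\mathscr{O}$ is the ideal octagon containing $\sqrt{-1}$ bounded by $E_0,\dots,E_7$.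 The images of $\mathscr{O}$ under $V_P$ are the tiles of the ideal octagon tessellation of $\mathbb{H}$. Ray. $r_\theta$ is the geodesic ray in $\mathbb{H}$ from $\sqrt{-1}$ to the boundary point $-\tan\theta\in\mathbb{R}\cup\{\infty\}$ (the projection of the Teichmüller geodesic ray contracting the direction $\theta$). The direction $\theta$ is cuspidal if $r_\theta$ converges to an ideal vertex of the tessellation. Normalized cutting sequence $\bar c(r_\theta)$. The first symbol $\bar c(r_\theta)_0$ is the $k\in\{0,\dots,7\}$ such that $r_\theta$ leaves $\mathscr{O}$ through $E_k$. For $l\ge1$, let $\mathscr{O}'$ be the $l$-th tile entered by $r_\theta$ after leaving $\mathscr{O}$, with entering side $E'$ and exiting side $E''$; let $\nu'\in V_P$ be the unique element whose right action sends $\mathscr{O}'$ to $\mathscr{O}$ and $E'$ to $E_0$; then $\bar c(r_\theta)_l$ is the $k\in\{1,\dots,7\}$ such that $\nu'$ sends $E''$ to $E_k$. *)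

theory Defs
  imports "HOL-Algebra.Generated_Groups" "HOL-Analysis.Analysis"
begin

section \<open>Matrices\<close>

definition mat2 :: "real \<Rightarrow> real \<Rightarrow> real \<Rightarrow> real \<Rightarrow> real^2^2" where
  "mat2 a b c d = vector [vector [a, b], vector [c, d]]"

lemma mat2_nth [simp]:
  "mat2 a b c d $ 1 $ 1 = a" "mat2 a b c d $ 1 $ 2 = b"
  "mat2 a b c d $ 2 $ 1 = c" "mat2 a b c d $ 2 $ 2 = d"
  by (simp_all add: mat2_def)

lemma det_mat2 [simp]: "det (mat2 a b c d) = a * d - b * c"
  by (simp add: det_2)

definition alpha_mat :: "real^2^2" where
  "alpha_mat = mat2 1 0 0 (-1)"

definition gamma_mat :: "real^2^2" where
  "gamma_mat = mat2 (-1) (2 * (1 + sqrt 2)) 0 1"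

text \<open>Only the indices \<open>0, \<dots>, 7\<close> are meaningful.\<close>

definition nu_mat :: "nat \<Rightarrow> real^2^2" where
  "nu_mat i =
    [mat2 1 0 0 1,
     (1 / sqrt 2) *\<^sub>R mat2 1 1 1 (-1),
     (1 / sqrt 2) *\<^sub>R mat2 1 1 (-1) 1,
     mat2 0 1 1 0,
     mat2 0 1 (-1) 0,
     (1 / sqrt 2) *\<^sub>R mat2 (-1) 1 1 1,
     (1 / sqrt 2) *\<^sub>R mat2 (-1) 1 (-1) (-1),
     mat2 (-1) 0 0 1] ! i"

definition beta_mat :: "real^2^2" where
  "beta_mat = nu_mat 1"

section \<open>The real projective line\<close>

text \<open>The set \<open>\<real> \<union> {\<infinity>}\<close>, used both for inverse slope coordinates of lines and for the
  boundary of the upper half-plane.\<close>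

datatype rp1 = Fin real | Infty

fun moebius :: "real^2^2 \<Rightarrow> rp1 \<Rightarrow> rp1" where
  "moebius L (Fin u) =
    (if L$2$1 * u + L$2$2 = 0 then Infty
     else Fin ((L$1$1 * u + L$1$2) / (L$2$1 * u + L$2$2)))"
| "moebius L Infty = (if L$2$1 = 0 then Infty else Fin (L$1$1 / L$2$1))"

section \<open>The octagon Farey map and the octagon additive continued fraction\<close>

definition inv_slope :: "real \<Rightarrow> rp1" where
  "inv_slope \<theta> = (if sin \<theta> = 0 then Infty else Fin (cot \<theta>))"

text \<open>The angles \<open>0\<close> and \<open>\<pi>\<close> give the same line. The branches of the Farey map take values in the
  sectors \<open>1, \<dots>, 7\<close>, that is in \<open>[\<pi>/8, \<pi>]\<close>, so their values at the line \<open>\<infinity>\<close> are read as \<open>\<pi>\<close>.\<close>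

definition angle_coord :: "rp1 \<Rightarrow> real" where
  "angle_coord u = (THE \<theta>. 0 < \<theta> \<and> \<theta> \<le> pi \<and> inv_slope \<theta> = u)"

definition sector :: "nat \<Rightarrow> real set" where
  "sector i = {real i * pi / 8 .. real (i + 1) * pi / 8}"

definition farey_branch :: "nat \<Rightarrow> real \<Rightarrow> real" where
  "farey_branch i \<theta> = angle_coord (moebius (gamma_mat ** nu_mat i) (inv_slope \<theta>))"

text \<open>\<open>farey_cylinder [s\<^sub>0, \<dots>, s\<^sub>k]\<close> is \<open>F\<^bsub>s\<^sub>0\<^esub>\<inverse> (F\<^bsub>s\<^sub>1\<^esub>\<inverse> (\<dots> F\<^bsub>s\<^sub>k\<^esub>\<inverse> [0, \<pi>]))\<close>.\<close>

fun farey_cylinder :: "nat list \<Rightarrow> real set" where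
  "farey_cylinder [] = {0..pi}"
| "farey_cylinder (i # is) = {\<theta> \<in> sector i. farey_branch i \<theta> \<in> farey_cylinder is}"

definition octagon_expansion :: "real \<Rightarrow> (nat \<Rightarrow> nat) \<Rightarrow> bool" where
  "octagon_expansion \<theta> s \<longleftrightarrow>
    (\<forall>k. s k \<in> {0..7}) \<and> (\<forall>k\<ge>1. s k \<noteq> 0) \<and>
    (\<Inter>k. farey_cylinder (map s [0..<Suc k])) = {\<theta>}"

section \<open>The projective Veech group and its right action\<close>

definition GL2 :: "(real^2^2) monoid" where
  "GL2 = \<lparr>carrier = {A. invertible A}, monoid.mult = (**), one = mat 1\<rparr>"

definition scalar_matrices :: "(real^2^2) set" where
  "scalar_matrices = {c *\<^sub>R mat 1 |c. c \<noteq> 0}"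

definition PGL2 :: "(real^2^2) set monoid" where
  "PGL2 = GL2 Mod scalar_matrices"

definition proj_class :: "real^2^2 \<Rightarrow> (real^2^2) set" where
  "proj_class A = scalar_matrices #>\<^bsub>GL2\<^esub> A"

definition V\<^sub>P :: "(real^2^2) set set" where
  "V\<^sub>P = generate PGL2 {proj_class alpha_mat, proj_class beta_mat, proj_class gamma_mat}"

definition upper_half_plane :: "complex set" where
  "upper_half_plane = {z. Im z > 0}"

text \<open>Right action of matrices of determinant \<open>\<plusminus>1\<close>.\<close>

definition right_act :: "complex \<Rightarrow> real^2^2 \<Rightarrow> complex" where
  "right_act z A =
    (let w = (if det A > 0 then z else cnj z) in
      (of_real (A$1$1) * w + of_real (A$2$1)) / (of_real (A$1$2) * w + of_real (A$2$2)))"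

text \<open>On the boundary the right action is \<open>x \<mapsto> (a x + c) / (b x + d)\<close>, hence the transpose.\<close>

definition right_act_bdry :: "rp1 \<Rightarrow> real^2^2 \<Rightarrow> rp1" where
  "right_act_bdry x A = moebius (transpose A) x"

text \<open>A class in \<open>PGL(2, \<real>)\<close> acts through its representatives of determinant \<open>\<plusminus>1\<close>, which are unique
  up to sign and all act in the same way.\<close>

definition proj_act :: "complex \<Rightarrow> (real^2^2) set \<Rightarrow> complex" where
  "proj_act z g = the_elem (right_act z ` {A \<in> g. \<bar>det A\<bar> = 1})"

definition proj_act_bdry :: "rp1 \<Rightarrow> (real^2^2) set \<Rightarrow> rp1" where
  "proj_act_bdry x g = the_elem (right_act_bdry x ` {A \<in> g. \<bar>det A\<bar> = 1})"

definition proj_image :: "complex set \<Rightarrow> (real^2^2) set \<Rightarrow> complex set" where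
  "proj_image X g = (\<lambda>z. proj_act z g) ` X"

section \<open>The ideal octagon tessellation\<close>

definition geodesic :: "real \<Rightarrow> real \<Rightarrow> complex set" where
  "geodesic x y =
    {z \<in> upper_half_plane. cmod (z - of_real ((x + y) / 2)) = \<bar>x - y\<bar> / 2}"

definition side0 :: "complex set" where
  "side0 = geodesic 0 (1 - sqrt 2)"

definition side :: "nat \<Rightarrow> complex set" where
  "side i = (\<lambda>z. right_act z (nu_mat i)) ` side0"

text \<open>The closed half-plane bounded by \<open>side0\<close> that contains \<open>\<i>\<close>.\<close>

definition half_plane0 :: "complex set" where
  "half_plane0 =
    {z \<in> upper_half_plane. cmod (z - of_real ((1 - sqrt 2) / 2)) \<ge> (sqrt 2 - 1) / 2}"

text \<open>Every \<open>nu_mat i\<close> fixes \<open>\<i>\<close>, so the image of \<open>half_plane0\<close> under it is the closed half-plane bounded by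
  \<open>side i\<close> that contains \<open>\<i>\<close>.\<close>

definition octagon :: "complex set" where
  "octagon = (\<Inter>i\<in>{0..7}. (\<lambda>z. right_act z (nu_mat i)) ` half_plane0)"

definition tiles :: "complex set set" where
  "tiles = {proj_image octagon g |g. g \<in> V\<^sub>P}"

definition is_side_of :: "complex set \<Rightarrow> complex set \<Rightarrow> bool" where
  "is_side_of E T \<longleftrightarrow>
    (\<exists>g\<in>V\<^sub>P. \<exists>i\<in>{0..7}. T = proj_image octagon g \<and> E = proj_image (side i) g)"

definition octagon_vertices :: "rp1 set" where
  "octagon_vertices =
    (\<Union>i\<in>{0..7}. {right_act_bdry (Fin 0) (nu_mat i), right_act_bdry (Fin (1 - sqrt 2)) (nu_mat i)})"

definition ideal_vertices :: "rp1 set" where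
  "ideal_vertices = {proj_act_bdry v g |v g. v \<in> octagon_vertices \<and> g \<in> V\<^sub>P}"

section \<open>Teichmueller rays\<close>

fun tends_to_bdry :: "(real \<Rightarrow> complex) \<Rightarrow> rp1 \<Rightarrow> bool" where
  "tends_to_bdry r (Fin x) \<longleftrightarrow> (r \<longlongrightarrow> complex_of_real x) at_top"
| "tends_to_bdry r Infty \<longleftrightarrow> filterlim r at_infinity at_top"

text \<open>The point of parameter \<open>t\<close> is the image of \<open>\<i>\<close> under the matrix
  \<open>diag (e\<^bsup>t/2\<^esup>, e\<^bsup>-t/2\<^esup>)\<close> composed with the rotation taking the direction \<open>\<theta>\<close> to the vertical direction,
  acting on the right. The lemmas below state that this is the unit speed geodesic ray from
  \<open>\<i>\<close> to \<open>- tan \<theta>\<close>.\<close>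

definition teich_ray :: "real \<Rightarrow> real \<Rightarrow> complex" where
  "teich_ray \<theta> t = right_act \<i>
    (mat2 (exp (t / 2) * sin \<theta>) (- exp (t / 2) * cos \<theta>)
          (exp (- t / 2) * cos \<theta>) (exp (- t / 2) * sin \<theta>))"

lemma teich_ray_eq:
  "teich_ray \<theta> t =
    (of_real (cos \<theta>) + \<i> * of_real (exp t * sin \<theta>)) /
    (of_real (sin \<theta>) - \<i> * of_real (exp t * cos \<theta>))"
proof -
  have e: "exp (- t / 2) * exp (t / 2) = (1::real)" "exp t = exp (t / 2) * exp (t / 2)"
    by (simp_all only: exp_add[symmetric] field_sum_of_halves) simp
  have d: "exp (t / 2) * sin \<theta> * (exp (- t / 2) * sin \<theta>) -
      (- exp (t / 2) * cos \<theta>) * (exp (- t / 2) * cos \<theta>) = 1"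
  proof -
    have "exp (t / 2) * sin \<theta> * (exp (- t / 2) * sin \<theta>) -
        (- exp (t / 2) * cos \<theta>) * (exp (- t / 2) * cos \<theta>) =
        (exp (- t / 2) * exp (t / 2)) * ((sin \<theta>)\<^sup>2 + (cos \<theta>)\<^sup>2)"
      by algebra
    then show ?thesis by (simp only: e(1) sin_cos_squared_add mult_1)
  qed
  define h where "h = complex_of_real (exp (t / 2))"
  have h0: "h \<noteq> 0" by (simp add: h_def)
  have "exp (- t / 2) = 1 / exp (t / 2)"
    using e(1) by (simp add: field_simps)
  then have h1: "complex_of_real (exp (- t / 2)) = 1 / h" by (simp add: h_def)
  have h2: "complex_of_real (exp t) = h * h" by (simp add: h_def flip: of_real_mult e(2))
  have "teich_ray \<theta> t =
    (h * of_real (sin \<theta>) * \<i> + 1 / h * of_real (cos \<theta>)) /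
    (- h * of_real (cos \<theta>) * \<i> + 1 / h * of_real (sin \<theta>))"
    unfolding teich_ray_def right_act_def det_mat2 d mat2_nth Let_def of_real_mult of_real_minus
      h1 h_def[symmetric] by simp
  also have "\<dots> = (h * (h * of_real (sin \<theta>) * \<i> + 1 / h * of_real (cos \<theta>))) /
    (h * (- h * of_real (cos \<theta>) * \<i> + 1 / h * of_real (sin \<theta>)))"
    using h0 by (rule mult_divide_mult_cancel_left[symmetric])
  also have "\<dots> = (of_real (cos \<theta>) + \<i> * of_real (exp t * sin \<theta>)) /
    (of_real (sin \<theta>) - \<i> * of_real (exp t * cos \<theta>))"
    unfolding of_real_mult h2 using h0
    by (simp add: distrib_left right_diff_distrib mult_ac add.commute)
  finally show ?thesis .
qed

lemma teich_ray_denom_pos: "(sin \<theta>)\<^sup>2 + (exp t * cos \<theta>)\<^sup>2 > (0::real)"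
proof (cases "cos \<theta> = 0")
  case True
  then show ?thesis using sin_cos_squared_add[of \<theta>] by simp
next
  case False
  then show ?thesis by (simp add: add_nonneg_pos)
qed

lemma teich_ray_0: "teich_ray \<theta> 0 = \<i>"
proof -
  have "of_real (sin \<theta>) - \<i> * of_real (cos \<theta>) \<noteq> (0::complex)"
    by (auto simp: complex_eq_iff dest: sin_zero_abs_cos_one)
  then show ?thesis by (simp add: teich_ray_eq field_simps)
qed

lemma Im_teich_ray:
  "Im (teich_ray \<theta> t) = exp t / ((sin \<theta>)\<^sup>2 + (exp t * cos \<theta>)\<^sup>2)"
proof -
  have "exp t * sin \<theta> * sin \<theta> + cos \<theta> * (exp t * cos \<theta>) =
      exp t * ((sin \<theta>)\<^sup>2 + (cos \<theta>)\<^sup>2)"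
    by (simp only: power2_eq_square distrib_left mult_ac)
  then show ?thesis by (simp add: teich_ray_eq Im_divide)
qed

lemma Im_teich_ray_pos: "Im (teich_ray \<theta> t) > 0"
  using teich_ray_denom_pos[of \<theta> t] by (simp add: Im_teich_ray)

text \<open>The right-hand side is the usual formula for \<open>cosh\<close> of the hyperbolic distance.\<close>

lemma teich_ray_geodesic:
  "cosh (t - u) = 1 + (cmod (teich_ray \<theta> t - teich_ray \<theta> u))\<^sup>2 /
    (2 * Im (teich_ray \<theta> t) * Im (teich_ray \<theta> u))"
proof -
  define D where "D x = of_real (sin \<theta>) - \<i> * complex_of_real (exp x * cos \<theta>)" for x
  define q where "q x = (sin \<theta>)\<^sup>2 + (exp x * cos \<theta>)\<^sup>2" for x
  have q: "(cmod (D x))\<^sup>2 = q x" for x by (simp add: D_def q_def cmod_power2)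
  have q0: "q x > 0" for x unfolding q_def by (rule teich_ray_denom_pos)
  have D0: "D x \<noteq> 0" for x using q[of x] q0[of x] by auto
  have sc: "complex_of_real (sin \<theta>) * of_real (sin \<theta>) = 1 - of_real (cos \<theta>) * of_real (cos \<theta>)"
  proof -
    have "sin \<theta> * sin \<theta> = 1 - cos \<theta> * cos \<theta>"
      using sin_squared_eq[of \<theta>] by (simp only: power2_eq_square)
    then show ?thesis by (metis of_real_1 of_real_diff of_real_mult)
  qed
  have "teich_ray \<theta> t - teich_ray \<theta> u = \<i> * of_real (exp t - exp u) / (D t * D u)"
  proof -
    have "(of_real (cos \<theta>) + \<i> * of_real (exp t * sin \<theta>)) * D u -
        (of_real (cos \<theta>) + \<i> * of_real (exp u * sin \<theta>)) * D t =
        \<i> * of_real (exp t - exp u) *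
          (of_real (sin \<theta>) * of_real (sin \<theta>) + of_real (cos \<theta>) * of_real (cos \<theta>))"
      unfolding D_def of_real_mult of_real_diff by algebra
    also have "\<dots> = \<i> * of_real (exp t - exp u)" by (simp add: sc)
    finally show ?thesis
      unfolding teich_ray_eq D_def[symmetric] diff_frac_eq[OF D0 D0] by simp
  qed
  then have "(cmod (teich_ray \<theta> t - teich_ray \<theta> u))\<^sup>2 = (exp t - exp u)\<^sup>2 / (q t * q u)"
    by (simp add: norm_divide norm_mult power_divide power_mult_distrib q
             flip: of_real_diff del: of_real_diff)
  moreover have "cosh (t - u) = 1 + (exp t - exp u)\<^sup>2 / (2 * exp t * exp u)"
    by (simp add: cosh_def exp_diff exp_minus field_simps power2_eq_square)
  moreover have "Im (teich_ray \<theta> x) = exp x / q x" for x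
    by (simp only: Im_teich_ray q_def)
  ultimately show ?thesis
    using q0[of t] q0[of u] by (simp add: field_simps)
qed

lemma teich_ray_endpoint:
  "tends_to_bdry (teich_ray \<theta>) (if cos \<theta> = 0 then Infty else Fin (- tan \<theta>))"
proof (cases "cos \<theta> = 0")
  case True
  then have s: "sin \<theta> \<noteq> 0" using sin_cos_squared_add[of \<theta>] by auto
  have "teich_ray \<theta> t = \<i> * of_real (exp t)" for t
    using True s by (simp add: teich_ray_eq)
  then have "norm (teich_ray \<theta> t) = exp t" for t by (simp add: norm_mult)
  then have "filterlim (teich_ray \<theta>) at_infinity at_top"
    using exp_at_top by (intro filterlim_norm_at_top_imp_at_infinity) simp
  with True show ?thesis by simp
next
  case False
  have e: "((\<lambda>t::real. complex_of_real (exp (- t))) \<longlongrightarrow> of_real 0) at_top"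
    by (intro tendsto_of_real filterlim_compose[OF exp_at_bot] filterlim_uminus_at_bot_at_top)
  have "teich_ray \<theta> t =
      (of_real (exp (- t)) * of_real (cos \<theta>) + \<i> * of_real (sin \<theta>)) /
      (of_real (exp (- t)) * of_real (sin \<theta>) - \<i> * of_real (cos \<theta>))" for t
  proof -
    define h where "h = complex_of_real (exp t)"
    have h0: "h \<noteq> 0" by (simp add: h_def)
    have h1: "complex_of_real (exp (- t)) = 1 / h" by (simp add: h_def exp_minus field_simps)
    have "teich_ray \<theta> t = (h * (1 / h * of_real (cos \<theta>) + \<i> * of_real (sin \<theta>))) /
        (h * (1 / h * of_real (sin \<theta>) - \<i> * of_real (cos \<theta>)))"
      using h0 unfolding teich_ray_eq of_real_mult h_def[symmetric]
      by (simp add: distrib_left right_diff_distrib mult_ac)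
    also have "\<dots> = (1 / h * of_real (cos \<theta>) + \<i> * of_real (sin \<theta>)) /
        (1 / h * of_real (sin \<theta>) - \<i> * of_real (cos \<theta>))"
      using h0 by (rule mult_divide_mult_cancel_left)
    finally show ?thesis by (simp only: h1)
  qed
  then have eq: "teich_ray \<theta> = (\<lambda>t.
      (of_real (exp (- t)) * of_real (cos \<theta>) + \<i> * of_real (sin \<theta>)) /
      (of_real (exp (- t)) * of_real (sin \<theta>) - \<i> * of_real (cos \<theta>)))"
    by (rule ext)
  have "(teich_ray \<theta> \<longlongrightarrow>
      (of_real 0 * of_real (cos \<theta>) + \<i> * of_real (sin \<theta>)) /
      (of_real 0 * of_real (sin \<theta>) - \<i> * of_real (cos \<theta>))) at_top"
    unfolding eq by (intro tendsto_intros e) (use False in simp)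
  moreover have "(of_real 0 * of_real (cos \<theta>) + \<i> * of_real (sin \<theta>)) /
      (of_real 0 * of_real (sin \<theta>) - \<i> * of_real (cos \<theta>)) = complex_of_real (- tan \<theta>)"
    using False by (simp add: tan_def)
  ultimately show ?thesis using False by simp
qed

definition cuspidal :: "real \<Rightarrow> bool" where
  "cuspidal \<theta> \<longleftrightarrow> (\<exists>v\<in>ideal_vertices. tends_to_bdry (teich_ray \<theta>) v)"

section \<open>The normalized cutting sequence\<close>

text \<open>The ray enters the tile \<open>T\<close> at time \<open>a\<close> and leaves it at time \<open>b\<close>.\<close>

definition traverses :: "(real \<Rightarrow> complex) \<Rightarrow> complex set \<Rightarrow> real \<Rightarrow> real \<Rightarrow> bool" where
  "traverses r T a b \<longleftrightarrow> T \<in> tiles \<and> a < b \<and> {t. 0 \<le> t \<and> r t \<in> T} = {a..b}"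

text \<open>\<open>nth_tile r l T a b\<close>: \<open>T\<close> is the \<open>l\<close>-th tile entered by \<open>r\<close> after leaving \<open>octagon\<close>
  (the \<open>0\<close>-th one being \<open>octagon\<close> itself), traversed between the times \<open>a\<close> and \<open>b\<close>.\<close>

inductive nth_tile :: "(real \<Rightarrow> complex) \<Rightarrow> nat \<Rightarrow> complex set \<Rightarrow> real \<Rightarrow> real \<Rightarrow> bool"
  for r :: "real \<Rightarrow> complex" where
  zero: "traverses r octagon 0 b \<Longrightarrow> nth_tile r 0 octagon 0 b"
| Suc: "nth_tile r l T a b \<Longrightarrow> traverses r T' b c \<Longrightarrow> nth_tile r (Suc l) T' b c"

definition normalizing_elem :: "complex set \<Rightarrow> complex set \<Rightarrow> (real^2^2) set" where
  "normalizing_elem T E =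
    (THE g. g \<in> V\<^sub>P \<and> proj_image T g = octagon \<and> proj_image E g = side0)"

definition cutting_symbol :: "(real \<Rightarrow> complex) \<Rightarrow> nat \<Rightarrow> nat \<Rightarrow> bool" where
  "cutting_symbol r l k \<longleftrightarrow>
    (if l = 0 then k \<in> {0..7} \<and> (\<exists>b. nth_tile r 0 octagon 0 b \<and> r b \<in> side k)
     else k \<in> {1..7} \<and>
       (\<exists>T a b E E'. nth_tile r l T a b \<and>
          is_side_of E T \<and> r a \<in> E \<and> is_side_of E' T \<and> r b \<in> E' \<and>
          proj_image E' (normalizing_elem T E) = side k))"

definition normalized_cutting_sequence :: "(real \<Rightarrow> complex) \<Rightarrow> nat \<Rightarrow> nat" where
  "normalized_cutting_sequence r l = (THE k. cutting_symbol r l k)"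

end

theory Submission
  imports Defs
begin

text \<open>
  The \<open>l\<close>-th tile met by the ray can be written down in advance: it is the image of the octagon under
  \<open>M\<^sub>l = \<gamma> \<nu>\<^bsub>s(l-1)\<^esub> \<dots> \<gamma> \<nu>\<^bsub>s(0)\<^esub>\<close> (\<open>tile_mat\<close>). The reason is that \<open>\<gamma>\<close> acts on the half-plane as
  the reflection in \<open>side0\<close>, so \<open>octagon \<gamma>\<close> is the neighbour of the octagon across \<open>side0\<close> and
  \<open>octagon \<gamma> \<nu>\<^sub>k\<close> is its neighbour across \<open>side k\<close>; the side \<open>side0 M\<^sub>l\<close> is common to the tiles \<open>l - 1\<close>
  and \<open>l\<close>. The same matrix \<open>M\<^sub>l\<close>, acting on directions from the left, is the \<open>l\<close>-fold composition
  of branches of the Farey map, because \<open>x = - 1 / u\<close> turns the left action of \<open>M\<^sub>l\<close> on inverse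
  slopes into the right action of its inverse on the boundary. Hence the \<open>l\<close>-th point of the Farey
  orbit lies in the sector \<open>s(l)\<close> exactly if the endpoint of the ray, seen from the \<open>l\<close>-th tile, lies
  behind the side \<open>s(l)\<close>. It cannot lie on the boundary of the sector, since that would make it an
  ideal vertex (\<open>fwd_eq_0_imp_cuspidal\<close>).

  Behind which sides the ray begins and ends decides which sides it crosses. The half-planes cut off
  by the eight sides are pairwise disjoint (\<open>walls_apart\<close>). The ray ends behind the side \<open>s(l)\<close> of the
  \<open>l\<close>-th tile, and for \<open>l \<ge> 1\<close> the geodesic begins behind the side \<open>0\<close> of that tile, which is the
  side it has just crossed. As \<open>s(l) \<noteq> 0\<close>, these are two different sides, so the geodesic enters
  through the one, leaves through the other and meets no third. Everything is quantitative: the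
  position of a point relative to a wall is the sign of a quadratic form \<open>wall_form\<close>, which along the
  ray equals \<open>e\<^sup>t P + e\<^sup>-\<^sup>t R\<close> up to a positive factor, where \<open>P\<close> and \<open>R\<close> are the values of the form at
  the two endpoints of the geodesic (\<open>wall_at_ray\<close>). The crossing times are therefore explicit.

  It remains to see that the cutting sequence, whose definition quantifies over all tiles, all their
  sides and all normalizing elements, leaves no other choice. This needs that tiles have disjoint
  interiors and that only the eight matrices \<open>\<nu>\<^sub>i\<close> preserve the octagon (\<open>tile_interior_unique\<close>,
  \<open>img_octagon_eqD\<close>). Both follow from a ping-pong argument: every element of the Veech group is \<open>\<nu>\<^sub>j\<close>
  or \<open>\<nu>\<^sub>j \<gamma> \<nu>\<^bsub>k(1)\<^esub> \<dots> \<gamma> \<nu>\<^bsub>k(n)\<^esub>\<close> with all \<open>k(i)\<close> but possibly the last nonzero, and such a word with \<open>n \<ge> 1\<close> moves the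
  octagon behind one of its sides (\<open>word_ping_pong\<close>).
\<close>

section \<open>Two by two matrices and their right action\<close>

lemma mat2_eq_iff: "A = B \<longleftrightarrow> A$1$1 = B$1$1 \<and> A$1$2 = B$1$2 \<and> A$2$1 = B$2$1 \<and> A$2$2 = B$2$2"
  for A B :: "real^2^2"
  by (auto simp: vec_eq_iff forall_2)

lemma matmul_nth [simp]:
  fixes A B :: "real^2^2"
  shows "(A ** B)$i$j = A$i$1 * B$1$j + A$i$2 * B$2$j"
  by (simp add: matrix_matrix_mult_def sum_2)

lemma mat_one_nth [simp]:
  "(mat 1 :: real^2^2)$1$1 = 1" "(mat 1 :: real^2^2)$1$2 = 0"
  "(mat 1 :: real^2^2)$2$1 = 0" "(mat 1 :: real^2^2)$2$2 = 1"
  by (simp_all add: mat_def)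

text \<open>The adjugate stands in for the inverse throughout: it agrees with the inverse up to a scalar, which
acts trivially, and its entries are polynomial in those of the matrix.\<close>

definition adj2 :: "real^2^2 \<Rightarrow> real^2^2" where
  "adj2 A = mat2 (A$2$2) (- A$1$2) (- A$2$1) (A$1$1)"

lemma adj2_nth [simp]:
  "adj2 A$1$1 = A$2$2" "adj2 A$1$2 = - A$1$2" "adj2 A$2$1 = - A$2$1" "adj2 A$2$2 = A$1$1"
  by (simp_all add: adj2_def)

lemma det_adj2 [simp]: "det (adj2 A) = det A"
  by (simp add: det_2)

lemma adj2_mult: "adj2 (A ** B) = adj2 B ** adj2 A"
  by (simp add: mat2_eq_iff algebra_simps)

lemma adj2_scale: "adj2 (c *\<^sub>R A) = c *\<^sub>R adj2 A"
  by (simp add: mat2_eq_iff)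

lemma mult_adj2: "A ** adj2 A = det A *\<^sub>R mat 1" "adj2 A ** A = det A *\<^sub>R mat 1"
  by (simp_all add: mat2_eq_iff det_2 algebra_simps)

lemma det_scale [simp]: "det (c *\<^sub>R A) = c\<^sup>2 * det A" for A :: "real^2^2"
  by (simp add: det_2 power2_eq_square algebra_simps)

lemma scale_mult: "(c *\<^sub>R A) ** B = c *\<^sub>R (A ** B)" "A ** (c *\<^sub>R B) = c *\<^sub>R (A ** B)"
  for A B :: "real^2^2"
  by (simp_all add: mat2_eq_iff algebra_simps)

lemma invertible_iff_det: "invertible A \<longleftrightarrow> det A \<noteq> 0" for A :: "real^2^2"
  by (simp add: invertible_det_nz)

text \<open>The right action splits into this fractional linear map and, for negative determinant, a complex
  conjugation, with which the map commutes.\<close>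

definition frac_lin :: "real^2^2 \<Rightarrow> complex \<Rightarrow> complex" where
  "frac_lin A w = (of_real (A$1$1) * w + of_real (A$2$1)) / (of_real (A$1$2) * w + of_real (A$2$2))"

lemma right_act_frac_lin: "right_act z A = frac_lin A (if det A > 0 then z else cnj z)"
  by (simp add: right_act_def frac_lin_def Let_def)

lemma frac_lin_denom_nonzero:
  fixes A :: "real^2^2"
  assumes "Im w \<noteq> 0" "det A \<noteq> 0"
  shows "of_real (A$1$2) * w + of_real (A$2$2) \<noteq> (0::complex)"
  using assms by (auto simp: complex_eq_iff det_2)

lemma cnj_frac_lin: "cnj (frac_lin A w) = frac_lin A (cnj w)"
  by (simp add: frac_lin_def)

lemma Im_frac_lin:
  "Im (frac_lin A w) = det A * Im w / (cmod (of_real (A$1$2) * w + of_real (A$2$2)))\<^sup>2"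
  by (simp add: frac_lin_def Im_divide cmod_power2 det_2 algebra_simps)

lemma frac_lin_mult:
  assumes "Im w \<noteq> 0" "det A \<noteq> 0" "det B \<noteq> 0"
  shows "frac_lin B (frac_lin A w) = frac_lin (A ** B) w"
proof -
  define n where "n = of_real (A$1$1) * w + of_real (A$2$1)"
  define d where "d = of_real (A$1$2) * w + of_real (A$2$2)"
  have d: "d \<noteq> 0" unfolding d_def by (rule frac_lin_denom_nonzero[OF assms(1,2)])
  have "frac_lin B (frac_lin A w) = (of_real (B$1$1) * (n / d) + of_real (B$2$1)) / (of_real (B$1$2) * (n / d) + of_real (B$2$2))"
    by (simp add: frac_lin_def n_def d_def)
  also have "\<dots> = (d * (of_real (B$1$1) * (n / d) + of_real (B$2$1))) / (d * (of_real (B$1$2) * (n / d) + of_real (B$2$2)))"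
    using d by (rule mult_divide_mult_cancel_left[symmetric])
  also have "\<dots> = (of_real (B$1$1) * n + of_real (B$2$1) * d) / (of_real (B$1$2) * n + of_real (B$2$2) * d)"
    using d by (simp add: distrib_left mult.left_commute[of d] mult.commute[of d])
  also have "\<dots> = frac_lin (A ** B) w"
    by (simp add: frac_lin_def n_def d_def algebra_simps)
  finally show ?thesis .
qed

lemma Im_right_act_pos:
  assumes "Im z > 0" "det A \<noteq> 0"
  shows "Im (right_act z A) > 0"
proof -
  have "of_real (A$1$2) * z + of_real (A$2$2) \<noteq> (0::complex)"
       "of_real (A$1$2) * cnj z + of_real (A$2$2) \<noteq> (0::complex)"
    using assms by (intro frac_lin_denom_nonzero; simp)+
  then show ?thesis using assms
    by (cases "det A > 0") (auto simp: right_act_frac_lin Im_frac_lin intro!: divide_pos_pos divide_neg_pos mult_neg_pos)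
qed

lemma right_act_mult:
  assumes "Im z > 0" "det A \<noteq> 0" "det B \<noteq> 0"
  shows "right_act (right_act z A) B = right_act z (A ** B)"
proof -
  have "Im z \<noteq> 0" "Im (cnj z) \<noteq> 0" using assms by auto
  then show ?thesis
    using assms(2,3)
    by (auto simp: right_act_frac_lin frac_lin_mult cnj_frac_lin det_mul zero_less_mult_iff not_less)
qed

lemma right_act_scale:
  assumes "c \<noteq> 0"
  shows "right_act z (c *\<^sub>R A) = right_act z A"
proof -
  have "frac_lin (c *\<^sub>R A) w = frac_lin A w" for w
  proof -
    have "frac_lin (c *\<^sub>R A) w = (of_real c * (of_real (A$1$1) * w + of_real (A$2$1))) /
        (of_real c * (of_real (A$1$2) * w + of_real (A$2$2)))"
      by (simp add: frac_lin_def algebra_simps)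
    then show ?thesis
      using assms by (simp add: frac_lin_def)
  qed
  moreover have "det (c *\<^sub>R A) > 0 \<longleftrightarrow> det A > 0"
    using assms by (simp add: zero_less_mult_iff)
  ultimately show ?thesis by (simp add: right_act_frac_lin del: det_scale)
qed

lemma right_act_one: "right_act z (mat 1) = z"
  by (simp add: right_act_frac_lin frac_lin_def)

lemma right_act_adj2:
  assumes "Im z > 0" "det A \<noteq> 0"
  shows "right_act (right_act z A) (adj2 A) = z" "right_act (right_act z (adj2 A)) A = z"
  using assms by (simp_all add: right_act_mult mult_adj2 right_act_scale right_act_one)

definition img :: "real^2^2 \<Rightarrow> complex set \<Rightarrow> complex set" where
  "img A X = (\<lambda>z. right_act z A) ` X"

lemma mem_img_iff:
  assumes "X \<subseteq> {z. Im z > 0}" "det A \<noteq> 0"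
  shows "z \<in> img A X \<longleftrightarrow> Im z > 0 \<and> right_act z (adj2 A) \<in> X"
proof
  assume "z \<in> img A X"
  then obtain y where "y \<in> X" "z = right_act y A" by (auto simp: img_def)
  with assms show "Im z > 0 \<and> right_act z (adj2 A) \<in> X"
    by (auto simp: Im_right_act_pos right_act_adj2)
next
  assume "Im z > 0 \<and> right_act z (adj2 A) \<in> X"
  then show "z \<in> img A X"
    using right_act_adj2(2)[of z A] assms(2) unfolding img_def by (metis imageI)
qed

lemma img_upper:
  assumes "X \<subseteq> {z. Im z > 0}" "det A \<noteq> 0"
  shows "img A X \<subseteq> {z. Im z > 0}"
  using mem_img_iff[OF assms] by auto

lemma img_mult:
  assumes "X \<subseteq> {z. Im z > 0}" "det A \<noteq> 0" "det B \<noteq> 0"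
  shows "img B (img A X) = img (A ** B) X"
proof -
  have "\<forall>z\<in>X. right_act (right_act z A) B = right_act z (A ** B)"
    using assms right_act_mult by auto
  then show ?thesis by (force simp: img_def)
qed

lemma img_scale: "c \<noteq> 0 \<Longrightarrow> img (c *\<^sub>R A) X = img A X"
  by (simp add: img_def right_act_scale)

lemma img_one: "img (mat 1) X = X"
  by (simp add: img_def right_act_one)

section \<open>Which side of a wall\<close>

text \<open>The function \<open>\<bar>z\<bar>\<^sup>2 + (\<surd>2 - 1) Re z\<close> vanishes on \<open>side0\<close>, is negative behind it and positive on the side
of \<open>\<i>\<close>. The numerator of its value at \<open>z A\<close> is linear in \<open>(\<bar>z\<bar>\<^sup>2, Re z, 1)\<close>, and this linear form is
\<open>wall_form A\<close>: its sign says on which side of the preimage of \<open>side0\<close> under \<open>A\<close> the point \<open>z\<close> lies.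
Evaluated at \<open>(p\<^sup>2, p q, q\<^sup>2)\<close> instead, it locates the boundary point \<open>p / q\<close> in the same way, so that
interior and boundary points are treated at once. Among the triples \<open>(m, x, w)\<close> with \<open>m, w \<ge> 0\<close>, those with \<open>x\<^sup>2 < m w\<close> are the
interior points up to scaling and the nonzero ones with \<open>x\<^sup>2 = m w\<close> the boundary points.\<close>

definition wall_form :: "real^2^2 \<Rightarrow> real \<Rightarrow> real \<Rightarrow> real \<Rightarrow> real" where
  "wall_form A m x w =
     A$1$1 * (A$1$1 + (sqrt 2 - 1) * A$1$2) * m
     + (2 * A$1$1 * A$2$1 + (sqrt 2 - 1) * (A$1$1 * A$2$2 + A$1$2 * A$2$1)) * x
     + A$2$1 * (A$2$1 + (sqrt 2 - 1) * A$2$2) * w"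

abbreviation wall_at :: "real^2^2 \<Rightarrow> complex \<Rightarrow> real" where
  "wall_at A z \<equiv> wall_form A ((cmod z)\<^sup>2) (Re z) 1"

lemma wall_form_mult:
  "wall_form (A ** B) m x w = wall_form B
     ((A$1$1)\<^sup>2 * m + 2 * A$1$1 * A$2$1 * x + (A$2$1)\<^sup>2 * w)
     (A$1$1 * A$1$2 * m + (A$1$1 * A$2$2 + A$1$2 * A$2$1) * x + A$2$1 * A$2$2 * w)
     ((A$1$2)\<^sup>2 * m + 2 * A$1$2 * A$2$2 * x + (A$2$2)\<^sup>2 * w)"
  unfolding wall_form_def matmul_nth by (simp only: power2_eq_square) algebra

lemma wall_form_scale: "wall_form (c *\<^sub>R A) m x w = c\<^sup>2 * wall_form A m x w"
  unfolding wall_form_def vector_scaleR_component by (simp only: power2_eq_square real_scaleR_def) algebra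

lemma wall_form_linear: "wall_form A (c * m) (c * x) (c * w) = c * wall_form A m x w"
  "wall_form A (m + m') (x + x') (w + w') = wall_form A m x w + wall_form A m' x' w'"
  by (simp_all add: wall_form_def algebra_simps)

lemma wall_form_row:
  "wall_form A (p\<^sup>2) (p * q) (q\<^sup>2) =
    (p * A$1$1 + q * A$2$1) * ((p * A$1$1 + q * A$2$1) + (sqrt 2 - 1) * (p * A$1$2 + q * A$2$2))"
  unfolding wall_form_def by (simp only: power2_eq_square) algebra

text \<open>This is where \<open>\<gamma>\<close> being the reflection in \<open>side0\<close> enters: it exchanges the two half-planes bounded by
\<open>side0\<close>.\<close>

lemma wall_form_gamma: "wall_form (A ** gamma_mat) m x w = - wall_form A m x w"
proof -
  have "(sqrt 2 - 1) * (2 * (1 + sqrt 2)) = 2" by (simp add: algebra_simps)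
  have "wall_form gamma_mat m x w = - wall_form (mat 1) m x w" for m x w
    unfolding wall_form_def gamma_mat_def mat2_nth mat_one_nth by (simp add: algebra_simps)
  then show ?thesis
    using wall_form_mult[of A gamma_mat] wall_form_mult[of A "mat 1"] by (simp only: matrix_mul_rid)
qed

text \<open>The factor is the squared absolute value of the denominator of \<open>z A\<close>. A conjugation in the right
action changes neither \<open>\<bar>z\<bar>\<close> nor \<open>Re z\<close>, so the sign of the determinant does not matter.\<close>

lemma wall_at_right_act:
  assumes "Im z > 0" "det A \<noteq> 0"
  shows "\<exists>D>0. wall_at (A ** B) z = D * wall_at B (right_act z A)"
proof -
  define w where "w = (if det A > 0 then z else cnj z)"
  define d where "d = of_real (A$1$2) * w + of_real (A$2$2)"
  define D where "D = (cmod d)\<^sup>2"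
  have w: "cmod w = cmod z" "Re w = Re z" by (auto simp: w_def)
  have "d \<noteq> 0" unfolding d_def using assms by (intro frac_lin_denom_nonzero) (auto simp: w_def)
  then have D: "D > 0" by (simp add: D_def)
  have r: "right_act z A = (of_real (A$1$1) * w + of_real (A$2$1)) / d"
    by (simp add: right_act_def w_def d_def Let_def)
  have 1: "(A$1$1)\<^sup>2 * (cmod z)\<^sup>2 + 2 * A$1$1 * A$2$1 * Re z + (A$2$1)\<^sup>2 * 1 = D * (cmod (right_act z A))\<^sup>2"
  proof -
    have "D * (cmod (right_act z A))\<^sup>2 = (cmod (of_real (A$1$1) * w + of_real (A$2$1)))\<^sup>2"
      using D by (simp add: r norm_divide power_divide D_def)
    then show ?thesis unfolding w(1)[symmetric] w(2)[symmetric] cmod_power2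
      by (simp add: power2_eq_square algebra_simps)
  qed
  have 3: "(A$1$2)\<^sup>2 * (cmod z)\<^sup>2 + 2 * A$1$2 * A$2$2 * Re z + (A$2$2)\<^sup>2 * 1 = D * 1"
    unfolding w(1)[symmetric] w(2)[symmetric] D_def d_def cmod_power2
    by (simp add: power2_eq_square algebra_simps)
  have 2: "A$1$1 * A$1$2 * (cmod z)\<^sup>2 + (A$1$1 * A$2$2 + A$1$2 * A$2$1) * Re z + A$2$1 * A$2$2 * 1 = D * Re (right_act z A)"
  proof -
    have "D * Re (right_act z A) = Re ((of_real (A$1$1) * w + of_real (A$2$1)) * cnj d)"
      using D by (simp add: r Re_divide D_def cmod_power2)
    then show ?thesis unfolding w(1)[symmetric] w(2)[symmetric] cmod_power2
      by (simp add: d_def power2_eq_square algebra_simps)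
  qed
  show ?thesis
    using D unfolding wall_form_mult[of A B] 1 2 3 wall_form_linear(1) by auto
qed

section \<open>The ideal octagon\<close>

text \<open>In the Klein disc model, with coordinates \<open>(2 x, m - w)\<close> relative to \<open>m + w\<close>, the sides of the octagon
are the chords of a regular octagon. The vector listed here is \<open>1 / cos (\<pi>/8)\<close> times the unit normal of the
\<open>i\<close>-th chord, pointing away from the centre \<open>\<i>\<close>.\<close>

definition wall_normal :: "nat \<Rightarrow> real \<times> real" where
  "wall_normal i = (let k = sqrt 2 - 1 in
    [(- k, -1), (-1, - k), (-1, k), (- k, 1), (k, 1), (1, k), (1, - k), (k, -1)] ! i)"

lemma le_7_cases:
  fixes i :: nat
  assumes "i \<le> 7"
  obtains "i = 0" | "i = 1" | "i = 2" | "i = 3" | "i = 4" | "i = 5" | "i = 6" | "i = 7"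
  using assms by linarith

lemma det_nu_nonzero: "i \<le> 7 \<Longrightarrow> det (nu_mat i) \<noteq> 0"
  by (erule le_7_cases) (simp_all add: nu_mat_def numeral_eq_Suc)

lemma wall_nu:
  assumes "i \<le> 7"
  shows "2 * wall_form (adj2 (nu_mat i)) m x w =
    (m + w) - fst (wall_normal i) * (2 * x) - snd (wall_normal i) * (m - w)"
  using assms
  by (rule le_7_cases)
    (simp_all add: wall_form_def nu_mat_def wall_normal_def numeral_eq_Suc Let_def divide_simps algebra_simps)

text \<open>Half the sum of two normals whose directions differ by \<open>\<delta>\<close> has length \<open>cos (\<delta>/2) / cos (\<pi>/8)\<close>, and \<open>\<delta> \<ge> \<pi>/4\<close>
for different sides. Equality holds for neighbouring sides, which share an ideal vertex.\<close>

lemma wall_normals_apart: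
  assumes "i \<le> 7" "j \<le> 7" "i \<noteq> j"
  shows "((fst (wall_normal i) + fst (wall_normal j)) / 2)\<^sup>2 + ((snd (wall_normal i) + snd (wall_normal j)) / 2)\<^sup>2 \<le> 1"
proof -
  define k :: real where "k = sqrt 2 - 1"
  have k: "k * k = 1 - 2 * k" "k > 0" "k < 1"
    using sqrt2_less_2 by (simp_all add: k_def algebra_simps)
  show ?thesis
    unfolding wall_normal_def k_def[symmetric] Let_def
    using assms(1)
    by (rule le_7_cases; use assms(2) in \<open>rule le_7_cases\<close>)
      (use assms(3) k in \<open>simp_all add: power2_eq_square numeral_eq_Suc field_simps\<close>)
qed

lemma disc_cauchy_schwarz:
  fixes a b m x w :: real
  assumes "a\<^sup>2 + b\<^sup>2 \<le> 1" "m \<ge> 0" "w \<ge> 0" "x\<^sup>2 \<le> m * w"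
  shows "a * (2 * x) + b * (m - w) \<le> m + w"
    and "x\<^sup>2 < m * w \<Longrightarrow> a * (2 * x) + b * (m - w) < m + w"
proof -
  have cs: "(a * (2 * x) + b * (m - w))\<^sup>2 \<le> (2 * x)\<^sup>2 + (m - w)\<^sup>2"
  proof -
    have "(a * (2 * x) + b * (m - w))\<^sup>2 \<le>
        (a * (2 * x) + b * (m - w))\<^sup>2 + (a * (m - w) - b * (2 * x))\<^sup>2"
      by simp
    also have "\<dots> = (a\<^sup>2 + b\<^sup>2) * ((2 * x)\<^sup>2 + (m - w)\<^sup>2)"
      by (simp only: power2_eq_square) algebra
    also have "\<dots> \<le> 1 * ((2 * x)\<^sup>2 + (m - w)\<^sup>2)"
      using assms(1) by (intro mult_right_mono) auto
    finally show ?thesis by simp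
  qed
  have eq: "(2 * x)\<^sup>2 + (m - w)\<^sup>2 = (m + w)\<^sup>2 - 4 * (m * w - x\<^sup>2)"
    by (simp only: power2_eq_square) algebra
  have cs': "(a * (2 * x) + b * (m - w))\<^sup>2 \<le> (m + w)\<^sup>2 - 4 * (m * w - x\<^sup>2)"
    using cs unfolding eq .
  have "m + w \<ge> 0" using assms by simp
  show "a * (2 * x) + b * (m - w) \<le> m + w"
    by (rule power2_le_imp_le[OF order_trans[OF cs'] \<open>m + w \<ge> 0\<close>]) (use assms(4) in simp)
  show "a * (2 * x) + b * (m - w) < m + w" if "x\<^sup>2 < m * w"
    by (rule power_less_imp_less_base[OF le_less_trans[OF cs'] \<open>m + w \<ge> 0\<close>]) (use that in simp)
qed

text \<open>The half-planes behind two different sides are disjoint, in a form that also serves on the boundary: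
the forms of the two walls cannot both be negative. Their sum is positive by the Cauchy--Schwarz
inequality, since in the Klein model its linear part has norm at most \<open>1\<close>.\<close>

lemma walls_apart:
  fixes m x w :: real
  assumes "i \<le> 7" "j \<le> 7" "i \<noteq> j" "m \<ge> 0" "w \<ge> 0" "x\<^sup>2 \<le> m * w"
  shows "wall_form (adj2 (nu_mat i)) m x w + wall_form (adj2 (nu_mat j)) m x w \<ge> 0"
    and "x\<^sup>2 < m * w \<Longrightarrow> wall_form (adj2 (nu_mat i)) m x w + wall_form (adj2 (nu_mat j)) m x w > 0"
proof -
  define a where "a = (fst (wall_normal i) + fst (wall_normal j)) / 2"
  define b where "b = (snd (wall_normal i) + snd (wall_normal j)) / 2"
  have ab: "a\<^sup>2 + b\<^sup>2 \<le> 1" unfolding a_def b_def by (rule wall_normals_apart[OF assms(1-3)])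
  have eq: "wall_form (adj2 (nu_mat i)) m x w + wall_form (adj2 (nu_mat j)) m x w =
      (m + w) - (a * (2 * x) + b * (m - w))"
    using wall_nu[OF assms(1), of m x w] wall_nu[OF assms(2), of m x w]
    by (simp add: a_def b_def field_simps)
  note cs = disc_cauchy_schwarz[OF ab assms(4-6)]
  show "wall_form (adj2 (nu_mat i)) m x w + wall_form (adj2 (nu_mat j)) m x w \<ge> 0"
    using cs(1) eq by linarith
  show "wall_form (adj2 (nu_mat i)) m x w + wall_form (adj2 (nu_mat j)) m x w > 0" if "x\<^sup>2 < m * w"
    using cs(2)[OF that] eq by linarith
qed

text \<open>Passing to the tile \<open>octagon A\<inverse>\<close> transforms \<open>(m, x, w)\<close> by a congruence, which keeps \<open>m\<close> and \<open>w\<close>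
nonnegative and multiplies the discriminant \<open>m w - x\<^sup>2\<close> by \<open>(det A)\<^sup>2\<close>.\<close>

lemma translated_walls_apart:
  fixes A :: "real^2^2"
  assumes "i \<le> 7" "j \<le> 7" "i \<noteq> j" "m \<ge> 0" "w \<ge> 0" "x\<^sup>2 \<le> m * w"
  shows "wall_form (A ** adj2 (nu_mat i)) m x w + wall_form (A ** adj2 (nu_mat j)) m x w \<ge> 0"
    and "x\<^sup>2 < m * w \<Longrightarrow> det A \<noteq> 0 \<Longrightarrow>
      wall_form (A ** adj2 (nu_mat i)) m x w + wall_form (A ** adj2 (nu_mat j)) m x w > 0"
proof -
  have pos: "p\<^sup>2 * m + 2 * p * q * x + q\<^sup>2 * w \<ge> 0" for p q
  proof -
    have "\<bar>x\<bar> \<le> sqrt m * sqrt w"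
      using assms(6) real_sqrt_le_mono[of "x\<^sup>2" "m * w"] by (simp add: real_sqrt_mult)
    then have "\<bar>2 * p * q * x\<bar> \<le> 2 * (\<bar>p\<bar> * sqrt m) * (\<bar>q\<bar> * sqrt w)"
      using mult_left_mono[of "\<bar>x\<bar>" "sqrt m * sqrt w" "2 * \<bar>p\<bar> * \<bar>q\<bar>"] by (simp add: abs_mult mult_ac)
    moreover have "p\<^sup>2 * m + q\<^sup>2 * w - 2 * (\<bar>p\<bar> * sqrt m) * (\<bar>q\<bar> * sqrt w) =
        (\<bar>p\<bar> * sqrt m - \<bar>q\<bar> * sqrt w)\<^sup>2"
      using assms(4,5) by (simp add: power2_diff power_mult_distrib)
    ultimately show ?thesis
      using zero_le_power2[of "\<bar>p\<bar> * sqrt m - \<bar>q\<bar> * sqrt w"] by linarith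
  qed
  let ?m = "(A$1$1)\<^sup>2 * m + 2 * A$1$1 * A$2$1 * x + (A$2$1)\<^sup>2 * w"
  let ?x = "A$1$1 * A$1$2 * m + (A$1$1 * A$2$2 + A$1$2 * A$2$1) * x + A$2$1 * A$2$2 * w"
  let ?w = "(A$1$2)\<^sup>2 * m + 2 * A$1$2 * A$2$2 * x + (A$2$2)\<^sup>2 * w"
  have disc: "?m * ?w - ?x\<^sup>2 = (det A)\<^sup>2 * (m * w - x\<^sup>2)"
    unfolding det_2 by (simp only: power2_eq_square) algebra
  have le: "?x\<^sup>2 \<le> ?m * ?w"
  proof -
    have "(det A)\<^sup>2 * (m * w - x\<^sup>2) \<ge> 0" using assms(6) by simp
    then show ?thesis unfolding disc[symmetric] by simp
  qed
  note apart = walls_apart[OF assms(1-3) pos[of "A$1$1" "A$2$1"] pos[of "A$1$2" "A$2$2"] le]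
  show "wall_form (A ** adj2 (nu_mat i)) m x w + wall_form (A ** adj2 (nu_mat j)) m x w \<ge> 0"
    unfolding wall_form_mult[of A] by (rule apart(1))
  assume "x\<^sup>2 < m * w" "det A \<noteq> 0"
  then have "(det A)\<^sup>2 * (m * w - x\<^sup>2) > 0"
    by (intro mult_pos_pos) simp_all
  then have "?x\<^sup>2 < ?m * ?w" using disc by linarith
  then show "wall_form (A ** adj2 (nu_mat i)) m x w + wall_form (A ** adj2 (nu_mat j)) m x w > 0"
    unfolding wall_form_mult[of A] by (rule apart(2))
qed

lemma Re_square_less: "Im z > 0 \<Longrightarrow> (Re z)\<^sup>2 < (cmod z)\<^sup>2 * 1"
  by (simp add: cmod_power2)

lemma translated_walls_apart_at:
  fixes A :: "real^2^2"
  assumes "i \<le> 7" "j \<le> 7" "i \<noteq> j" "Im z > 0" "det A \<noteq> 0"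
  shows "wall_at (A ** adj2 (nu_mat i)) z + wall_at (A ** adj2 (nu_mat j)) z > 0"
  using translated_walls_apart(2)[OF assms(1-3), of "(cmod z)\<^sup>2" 1 "Re z" A] Re_square_less[OF assms(4)] assms(5)
  by simp

lemma side_circle:
  "(cmod (z - of_real ((1 - sqrt 2) / 2)))\<^sup>2 = wall_at (mat 1) z + ((sqrt 2 - 1) / 2)\<^sup>2"
  unfolding cmod_power2 wall_form_def mat_one_nth by (simp add: power2_eq_square field_simps)

lemma half_plane0_iff: "z \<in> half_plane0 \<longleftrightarrow> Im z > 0 \<and> wall_at (mat 1) z \<ge> 0"
proof -
  have "cmod (z - of_real ((1 - sqrt 2) / 2)) \<ge> (sqrt 2 - 1) / 2 \<longleftrightarrow>
      (cmod (z - of_real ((1 - sqrt 2) / 2)))\<^sup>2 \<ge> ((sqrt 2 - 1) / 2)\<^sup>2"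
    by (rule power_mono_iff[symmetric]) auto
  then show ?thesis
    unfolding half_plane0_def upper_half_plane_def side_circle by auto
qed

lemma side0_iff: "z \<in> side0 \<longleftrightarrow> Im z > 0 \<and> wall_at (mat 1) z = 0"
proof -
  have "cmod (z - of_real ((1 - sqrt 2) / 2)) = (sqrt 2 - 1) / 2 \<longleftrightarrow>
      (cmod (z - of_real ((1 - sqrt 2) / 2)))\<^sup>2 = ((sqrt 2 - 1) / 2)\<^sup>2"
    by (rule power_eq_iff_eq_base[symmetric]) auto
  then show ?thesis
    unfolding side0_def geodesic_def upper_half_plane_def side_circle by auto
qed

lemma half_plane0_upper: "half_plane0 \<subseteq> {z. Im z > 0}"
  and side0_upper: "side0 \<subseteq> {z. Im z > 0}"
  by (auto simp: half_plane0_iff side0_iff)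

lemma wall_at_right_act_sign:
  assumes "Im z > 0" "det A \<noteq> 0"
  shows "wall_at B (right_act z A) \<ge> 0 \<longleftrightarrow> wall_at (A ** B) z \<ge> 0"
    and "wall_at B (right_act z A) = 0 \<longleftrightarrow> wall_at (A ** B) z = 0"
    and "wall_at B (right_act z A) > 0 \<longleftrightarrow> wall_at (A ** B) z > 0"
  using wall_at_right_act[OF assms, of B] by (auto simp: zero_le_mult_iff zero_less_mult_iff)

lemma img_half_plane0_iff:
  "det A \<noteq> 0 \<Longrightarrow> z \<in> img A half_plane0 \<longleftrightarrow> Im z > 0 \<and> wall_at (adj2 A) z \<ge> 0"
  by (auto simp: mem_img_iff[OF half_plane0_upper] half_plane0_iff Im_right_act_pos
      wall_at_right_act_sign)

lemma img_side0_iff: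
  "det A \<noteq> 0 \<Longrightarrow> z \<in> img A side0 \<longleftrightarrow> Im z > 0 \<and> wall_at (adj2 A) z = 0"
  by (auto simp: mem_img_iff[OF side0_upper] side0_iff Im_right_act_pos
      wall_at_right_act_sign)

lemma side_img: "side i = img (nu_mat i) side0"
  by (simp add: side_def img_def)

lemma side_upper: "i \<le> 7 \<Longrightarrow> side i \<subseteq> {z. Im z > 0}"
  unfolding side_img using img_upper[OF side0_upper det_nu_nonzero] .

lemma octagon_iff: "z \<in> octagon \<longleftrightarrow> Im z > 0 \<and> (\<forall>i\<le>7. wall_at (adj2 (nu_mat i)) z \<ge> 0)"
proof -
  have "z \<in> octagon \<longleftrightarrow> (\<forall>i\<le>7. z \<in> img (nu_mat i) half_plane0)"
    by (auto simp: octagon_def img_def)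
  also have "\<dots> \<longleftrightarrow> Im z > 0 \<and> (\<forall>i\<le>7. wall_at (adj2 (nu_mat i)) z \<ge> 0)"
    by (auto simp: img_half_plane0_iff det_nu_nonzero)
  finally show ?thesis .
qed

lemma octagon_upper: "octagon \<subseteq> {z. Im z > 0}"
  by (auto simp: octagon_iff)

lemma img_octagon_iff:
  assumes "det A \<noteq> 0"
  shows "z \<in> img A octagon \<longleftrightarrow> Im z > 0 \<and> (\<forall>i\<le>7. wall_at (adj2 A ** adj2 (nu_mat i)) z \<ge> 0)"
  using assms
  by (auto simp: mem_img_iff[OF octagon_upper] octagon_iff Im_right_act_pos wall_at_right_act_sign)

lemma img_side_iff:
  assumes "det A \<noteq> 0" "i \<le> 7"
  shows "z \<in> img A (side i) \<longleftrightarrow> Im z > 0 \<and> wall_at (adj2 A ** adj2 (nu_mat i)) z = 0"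
  using assms unfolding side_img
  by (simp add: img_mult[OF side0_upper] det_nu_nonzero img_side0_iff det_mul adj2_mult)

lemma img_sides_disjoint:
  assumes "det A \<noteq> 0" "i \<le> 7" "j \<le> 7" "z \<in> img A (side i)" "z \<in> img A (side j)"
  shows "i = j"
proof (rule ccontr)
  assume "i \<noteq> j"
  with assms translated_walls_apart_at[of i j z "adj2 A"] show False
    by (simp add: img_side_iff)
qed

lemma nu_mat_0: "nu_mat 0 = mat 1"
  by (simp add: nu_mat_def mat2_eq_iff)

lemma side_0: "side 0 = side0"
  by (simp add: side_img nu_mat_0 img_one)

lemma side0_nonempty: "side0 \<noteq> {}"
proof -
  have "Complex ((1 - sqrt 2) / 2) ((sqrt 2 - 1) / 2) \<in> side0"
    unfolding side0_iff cmod_power2 wall_form_def mat_one_nth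
    by (simp add: power2_eq_square field_simps)
  then show ?thesis by auto
qed

lemma img_side_inject:
  assumes "det A \<noteq> 0" "i \<le> 7" "j \<le> 7" "img A (side i) = img A (side j)"
  shows "i = j"
proof -
  obtain z where "z \<in> img A (side i)"
    using side0_nonempty unfolding side_img img_def by blast
  then show ?thesis using img_sides_disjoint[OF assms(1-3)] assms(4) by blast
qed

text \<open>The numbering of the eight symmetries pairs every reflection with a rotation, so that
  composing with either of the two generating reflections swaps neighbours in the cyclic order.\<close>

lemma nu_mult_refl:
  assumes "i \<le> 7"
  shows "\<exists>j\<le>7. beta_mat ** nu_mat i = nu_mat j \<or> beta_mat ** nu_mat i = - nu_mat j"
    and "\<exists>j\<le>7. alpha_mat ** nu_mat i = nu_mat j \<or> alpha_mat ** nu_mat i = - nu_mat j"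
proof -
  have "beta_mat ** nu_mat i = nu_mat ([1,0,3,2,5,4,7,6] ! i) \<or> beta_mat ** nu_mat i = - nu_mat ([1,0,3,2,5,4,7,6] ! i)"
    using assms by (rule le_7_cases)
      (simp_all add: beta_mat_def nu_mat_def mat2_eq_iff numeral_eq_Suc field_simps)
  moreover have "[1,0,3,2,5,4,7,6] ! i \<le> (7::nat)"
    using assms by (rule le_7_cases) simp_all
  ultimately show "\<exists>j\<le>7. beta_mat ** nu_mat i = nu_mat j \<or> beta_mat ** nu_mat i = - nu_mat j"
    by blast
  have "alpha_mat ** nu_mat i = nu_mat ([7,2,1,4,3,6,5,0] ! i) \<or> alpha_mat ** nu_mat i = - nu_mat ([7,2,1,4,3,6,5,0] ! i)"
    using assms by (rule le_7_cases)
      (simp_all add: alpha_mat_def nu_mat_def mat2_eq_iff numeral_eq_Suc field_simps)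
  moreover have "[7,2,1,4,3,6,5,0] ! i \<le> (7::nat)"
    using assms by (rule le_7_cases) simp_all
  ultimately show "\<exists>j\<le>7. alpha_mat ** nu_mat i = nu_mat j \<or> alpha_mat ** nu_mat i = - nu_mat j"
    by blast
qed

section \<open>The projective Veech group\<close>

lemma GL2_simps [simp]:
  "carrier GL2 = {A. det A \<noteq> 0}" "A \<otimes>\<^bsub>GL2\<^esub> B = A ** B" "\<one>\<^bsub>GL2\<^esub> = mat 1"
  by (auto simp: GL2_def invertible_iff_det)

lemma group_GL2: "group GL2"
proof (rule groupI)
  fix A assume "A \<in> carrier GL2"
  then have "det A \<noteq> 0" by simp
  then have "(1 / det A) *\<^sub>R adj2 A \<in> carrier GL2" "(1 / det A) *\<^sub>R adj2 A \<otimes>\<^bsub>GL2\<^esub> A = \<one>\<^bsub>GL2\<^esub>"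
    by (simp_all add: scale_mult mult_adj2)
  then show "\<exists>B\<in>carrier GL2. B \<otimes>\<^bsub>GL2\<^esub> A = \<one>\<^bsub>GL2\<^esub>" by blast
qed (auto simp: det_mul matrix_mul_assoc)

lemma normal_scalar_matrices: "scalar_matrices \<lhd> GL2"
proof (rule group.normalI[OF group_GL2])
  have inv: "inv\<^bsub>GL2\<^esub> (c *\<^sub>R mat 1) = (1 / c) *\<^sub>R mat 1" if "c \<noteq> 0" for c
    by (rule group.inv_equality[OF group_GL2]) (use that in \<open>simp_all add: scale_mult\<close>)
  show "subgroup scalar_matrices GL2"
  proof
    show "scalar_matrices \<subseteq> carrier GL2" by (auto simp: scalar_matrices_def)
    show "\<one>\<^bsub>GL2\<^esub> \<in> scalar_matrices"
      unfolding scalar_matrices_def by (auto intro!: exI[of _ 1])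
    show "x \<otimes>\<^bsub>GL2\<^esub> y \<in> scalar_matrices" if xy: "x \<in> scalar_matrices" "y \<in> scalar_matrices" for x y
    proof -
      obtain c d where "c \<noteq> 0" "d \<noteq> 0" "x = c *\<^sub>R mat 1" "y = d *\<^sub>R mat 1"
        using xy by (auto simp: scalar_matrices_def)
      then show ?thesis
        unfolding scalar_matrices_def by (auto simp: scale_mult intro!: exI[of _ "c * d"])
    qed
    show "inv\<^bsub>GL2\<^esub> x \<in> scalar_matrices" if x: "x \<in> scalar_matrices" for x
    proof -
      obtain c where "c \<noteq> 0" "x = c *\<^sub>R mat 1" using x by (auto simp: scalar_matrices_def)
      then show ?thesis
        unfolding scalar_matrices_def by (auto simp: inv intro!: exI[of _ "1 / c"])
    qed
  qed
  show "\<forall>A\<in>carrier GL2. scalar_matrices #>\<^bsub>GL2\<^esub> A = A <#\<^bsub>GL2\<^esub> scalar_matrices"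
    by (auto simp: r_coset_def l_coset_def scalar_matrices_def scale_mult)
qed

lemma proj_class_eq: "proj_class A = {c *\<^sub>R A |c. c \<noteq> 0}"
  by (auto simp: proj_class_def r_coset_def scalar_matrices_def scale_mult)

lemma proj_class_self: "A \<in> proj_class A"
  unfolding proj_class_eq by (auto intro!: exI[of _ 1])

lemma proj_class_scale:
  assumes "c \<noteq> 0"
  shows "proj_class (c *\<^sub>R A) = proj_class A"
proof -
  have "d *\<^sub>R A \<in> proj_class (c *\<^sub>R A)" if "d \<noteq> 0" for d
    unfolding proj_class_eq using that assms by (auto intro!: exI[of _ "d / c"])
  moreover have "d *\<^sub>R c *\<^sub>R A \<in> proj_class A" if "d \<noteq> 0" for d
    unfolding proj_class_eq using that assms by (auto intro!: exI[of _ "d * c"])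
  ultimately show ?thesis by (auto simp: proj_class_eq)
qed

lemma proj_class_eqD: "proj_class A = proj_class B \<Longrightarrow> \<exists>c\<noteq>0. A = c *\<^sub>R B"
  using proj_class_self[of A] by (auto simp: proj_class_eq)

lemma group_PGL2: "group PGL2"
  unfolding PGL2_def by (rule normal.factorgroup_is_group[OF normal_scalar_matrices])

lemma proj_class_mult:
  assumes "det A \<noteq> 0" "det B \<noteq> 0"
  shows "proj_class A \<otimes>\<^bsub>PGL2\<^esub> proj_class B = proj_class (A ** B)"
  using normal.rcos_sum[OF normal_scalar_matrices, of A B] assms
  by (simp add: PGL2_def FactGroup_def proj_class_def)

lemma proj_class_one: "\<one>\<^bsub>PGL2\<^esub> = proj_class (mat 1)"
  by (simp add: PGL2_def FactGroup_def proj_class_eq scalar_matrices_def)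

lemma proj_class_carrier: "det A \<noteq> 0 \<Longrightarrow> proj_class A \<in> carrier PGL2"
  by (auto simp: PGL2_def FactGroup_def proj_class_def RCOSETS_def)

text \<open>The representatives of determinant \<open>\<plusminus>1\<close> in a class form a nonempty set on which a scaling invariant
function is constant, so both projective actions may be computed with an arbitrary representative.\<close>

lemma the_elem_unimodular:
  assumes "det A \<noteq> 0" "\<And>c. c \<noteq> 0 \<Longrightarrow> f (c *\<^sub>R A) = f A"
  shows "the_elem (f ` {B \<in> proj_class A. \<bar>det B\<bar> = 1}) = f A"
proof -
  define c where "c = 1 / sqrt \<bar>det A\<bar>"
  have c: "c \<noteq> 0" "c\<^sup>2 * \<bar>det A\<bar> = 1" using assms(1) by (simp_all add: c_def power_divide)
  have "c *\<^sub>R A \<in> {B \<in> proj_class A. \<bar>det B\<bar> = 1}"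
    using c by (auto simp: proj_class_eq abs_mult)
  moreover have "f B = f A" if "B \<in> proj_class A" for B
    using that assms(2) by (auto simp: proj_class_eq)
  ultimately have "f ` {B \<in> proj_class A. \<bar>det B\<bar> = 1} = {f A}"
    by fastforce
  then show ?thesis by simp
qed

lemma proj_act_class: "det A \<noteq> 0 \<Longrightarrow> proj_act z (proj_class A) = right_act z A"
  unfolding proj_act_def by (rule the_elem_unimodular) (simp_all add: right_act_scale)

lemma proj_image_class: "det A \<noteq> 0 \<Longrightarrow> proj_image X (proj_class A) = img A X"
  by (simp add: proj_image_def img_def proj_act_class)

lemma right_act_bdry_scale: "c \<noteq> 0 \<Longrightarrow> right_act_bdry x (c *\<^sub>R A) = right_act_bdry x A"
proof -
  assume c: "c \<noteq> 0"
  have e: "c * p * u + c * q = c * (p * u + q)" for p q u :: real by (simp add: algebra_simps)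
  show ?thesis using c
    by (cases x) (simp_all add: right_act_bdry_def transpose_def e)
qed

lemma proj_act_bdry_class: "det A \<noteq> 0 \<Longrightarrow> proj_act_bdry x (proj_class A) = right_act_bdry x A"
  unfolding proj_act_bdry_def by (rule the_elem_unimodular) (simp_all add: right_act_bdry_scale)

text \<open>All matrices representing elements of \<open>V\<^sub>P\<close>; working with these avoids choosing representatives.\<close>

definition veech :: "(real^2^2) set" where
  "veech = {A. det A \<noteq> 0 \<and> proj_class A \<in> V\<^sub>P}"

lemma det_alpha_beta_gamma [simp]: "det alpha_mat = -1" "det beta_mat = -1" "det gamma_mat = -1"
  by (simp_all add: alpha_mat_def beta_mat_def nu_mat_def gamma_mat_def power_divide)

lemma generators_carrier: "{proj_class alpha_mat, proj_class beta_mat, proj_class gamma_mat} \<subseteq> carrier PGL2"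
  by (simp add: proj_class_carrier)

lemma subgroup_VP: "subgroup V\<^sub>P PGL2"
  unfolding V\<^sub>P_def by (rule group.generate_is_subgroup[OF group_PGL2 generators_carrier])

lemma veech_det: "A \<in> veech \<Longrightarrow> det A \<noteq> 0"
  by (simp add: veech_def)

lemma veech_mult: "A \<in> veech \<Longrightarrow> B \<in> veech \<Longrightarrow> A ** B \<in> veech"
  using subgroup.m_closed[OF subgroup_VP, of "proj_class A" "proj_class B"]
  by (simp add: veech_def proj_class_mult det_mul)

lemma veech_one: "mat 1 \<in> veech"
  using subgroup.one_closed[OF subgroup_VP] by (simp add: veech_def proj_class_one)

lemma veech_adj2:
  assumes "A \<in> veech"
  shows "adj2 A \<in> veech"
proof -
  have d: "det A \<noteq> 0" using assms by (rule veech_det)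
  have "inv\<^bsub>PGL2\<^esub> (proj_class A) = proj_class (adj2 A)"
    using d by (intro group.inv_equality[OF group_PGL2])
      (simp_all add: proj_class_mult proj_class_carrier mult_adj2 proj_class_scale proj_class_one)
  then show ?thesis
    using subgroup.m_inv_closed[OF subgroup_VP, of "proj_class A"] assms by (simp add: veech_def)
qed

lemma veech_generators: "alpha_mat \<in> veech" "beta_mat \<in> veech" "gamma_mat \<in> veech"
  by (auto simp: veech_def V\<^sub>P_def intro: generate.incl)

lemma nu_generated:
  assumes "i \<le> 7" "beta_mat \<in> S" "alpha_mat \<in> S" "mat 1 \<in> S"
    and mult: "\<And>A B. A \<in> S \<Longrightarrow> B \<in> S \<Longrightarrow> A ** B \<in> S"
  shows "nu_mat i \<in> S"
proof -
  let ?b = "beta_mat" and ?r = "alpha_mat ** beta_mat"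
  have eqs: "nu_mat 0 = mat 1" "nu_mat 1 = ?b" "nu_mat 2 = ?r" "nu_mat 3 = ?b ** ?r"
    "nu_mat 4 = ?r ** ?r" "nu_mat 5 = ?b ** ?r ** ?r" "nu_mat 6 = ?r ** ?r ** ?r" 
    "nu_mat 7 = ?b ** ?r ** ?r ** ?r"
    by (simp_all add: nu_mat_def alpha_mat_def beta_mat_def mat2_eq_iff numeral_eq_Suc field_simps)
  show ?thesis
    using assms(1) by (rule le_7_cases) (simp_all only: eqs mult assms(2-4))
qed

lemma veech_nu: "i \<le> 7 \<Longrightarrow> nu_mat i \<in> veech"
  by (erule nu_generated) (simp_all add: veech_generators veech_one veech_mult)

text \<open>Reduced words: the letter \<open>\<nu>\<^sub>0\<close> is the identity and would allow the cancellation \<open>\<gamma> \<nu>\<^sub>0 \<gamma> = 1\<close>, so it is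
allowed only at the right end, where no further \<open>\<gamma>\<close> follows.\<close>

inductive_set words :: "(real^2^2) set" where
  single: "k \<le> 7 \<Longrightarrow> gamma_mat ** nu_mat k \<in> words"
| snoc: "0 < k \<Longrightarrow> k \<le> 7 \<Longrightarrow> A \<in> words \<Longrightarrow> gamma_mat ** nu_mat k ** A \<in> words"

definition normal_form :: "real^2^2 \<Rightarrow> bool" where
  "normal_form B \<longleftrightarrow> (\<exists>j\<le>7. \<exists>c\<noteq>0. B = c *\<^sub>R nu_mat j \<or> (\<exists>A\<in>words. B = c *\<^sub>R (nu_mat j ** A)))"

lemma normal_form_scale: "c \<noteq> 0 \<Longrightarrow> normal_form B \<Longrightarrow> normal_form (c *\<^sub>R B)"
proof -
  assume c: "c \<noteq> 0" and "normal_form B"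
  then obtain j d where "j \<le> 7" "d \<noteq> 0" "B = d *\<^sub>R nu_mat j \<or> (\<exists>A\<in>words. B = d *\<^sub>R (nu_mat j ** A))"
    by (auto simp: normal_form_def)
  then show ?thesis
    using c unfolding normal_form_def
    by (intro exI[of _ j] conjI exI[of _ "c * d"]) auto
qed

lemma words_det: "A \<in> words \<Longrightarrow> det A \<noteq> 0"
  by (induction rule: words.induct) (simp_all add: det_mul det_nu_nonzero)

lemma normal_form_det: "normal_form B \<Longrightarrow> det B \<noteq> 0"
  by (auto simp: normal_form_def det_mul det_nu_nonzero words_det)

lemma normal_form_nu: "j \<le> 7 \<Longrightarrow> normal_form (nu_mat j)"
  unfolding normal_form_def by (rule exI[of _ j]) (auto intro!: exI[of _ 1])

lemma normal_form_nu_word: "j \<le> 7 \<Longrightarrow> A \<in> words \<Longrightarrow> normal_form (nu_mat j ** A)"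
  unfolding normal_form_def by (rule exI[of _ j]) (auto intro!: exI[of _ 1])

lemma gamma_gamma: "gamma_mat ** gamma_mat = mat 1"
  by (simp add: gamma_mat_def mat2_eq_iff)

lemma gamma_gamma_mult: "gamma_mat ** (gamma_mat ** A) = A"
  by (simp add: matrix_mul_assoc gamma_gamma)

lemma normal_form_reflect_mult:
  assumes "\<And>i. i \<le> 7 \<Longrightarrow> \<exists>j\<le>7. R ** nu_mat i = nu_mat j \<or> R ** nu_mat i = - nu_mat j"
    and "normal_form B"
  shows "normal_form (R ** B)"
proof -
  obtain j c where j: "j \<le> 7" "c \<noteq> 0" "B = c *\<^sub>R nu_mat j \<or> (\<exists>A\<in>words. B = c *\<^sub>R (nu_mat j ** A))"
    using assms(2) by (auto simp: normal_form_def)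
  obtain i d where i: "i \<le> 7" "d \<noteq> 0" "R ** nu_mat j = d *\<^sub>R nu_mat i"
    using assms(1)[OF j(1)] by (metis scaleR_minus_left scaleR_one neg_equal_0_iff_equal zero_neq_one)
  from j(3) have "R ** B = (c * d) *\<^sub>R nu_mat i \<or> (\<exists>A\<in>words. R ** B = (c * d) *\<^sub>R (nu_mat i ** A))"
  proof (elim disjE bexE)
    assume "B = c *\<^sub>R nu_mat j"
    then have "R ** B = (c * d) *\<^sub>R nu_mat i" by (simp add: scale_mult i)
    then show ?thesis ..
  next
    fix A assume A: "A \<in> words" "B = c *\<^sub>R (nu_mat j ** A)"
    then have "R ** B = (c * d) *\<^sub>R (nu_mat i ** A)"
      by (simp add: scale_mult matrix_mul_assoc i)
    then show ?thesis using A(1) by blast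
  qed
  moreover have "c * d \<noteq> 0" using i j by simp
  ultimately show ?thesis using i(1) unfolding normal_form_def by blast
qed

lemma normal_form_gamma_mult:
  assumes "normal_form B"
  shows "normal_form (gamma_mat ** B)"
proof -
  obtain j c where j: "j \<le> 7" "c \<noteq> 0" "B = c *\<^sub>R nu_mat j \<or> (\<exists>A\<in>words. B = c *\<^sub>R (nu_mat j ** A))"
    using assms(1) by (auto simp: normal_form_def)
  have word: "normal_form A" if "A \<in> words" for A
    using normal_form_nu_word[of 0 A] that by (simp add: nu_mat_0)
  from j(3) show ?thesis
  proof (elim disjE bexE)
    assume "B = c *\<^sub>R nu_mat j"
    then show ?thesis
      using j by (simp add: scale_mult normal_form_scale word words.single)
  next
    fix A assume A: "A \<in> words" "B = c *\<^sub>R (nu_mat j ** A)"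
    show ?thesis
    proof (cases "j = 0")
      case False
      then have "normal_form (gamma_mat ** nu_mat j ** A)"
        using A(1) j by (intro word words.snoc) auto
      then show ?thesis
        using A(2) j(2) by (simp add: scale_mult normal_form_scale matrix_mul_assoc)
    next
      case True
      from A(1) have "normal_form (gamma_mat ** A)"
      proof cases
        case (single k)
        then show ?thesis by (simp add: gamma_gamma_mult normal_form_nu)
      next
        case (snoc k A')
        then have "gamma_mat ** A = nu_mat k ** A'"
          by (simp add: gamma_gamma_mult flip: matrix_mul_assoc)
        then show ?thesis using snoc by (simp add: normal_form_nu_word)
      qed
      then show ?thesis
        using A(2) j(2) True by (simp add: scale_mult normal_form_scale nu_mat_0)
    qed
  qed
qed

text \<open>The classes of matrices in normal form contain the identity and are stable under multiplication from
the left by the three generators. The generators are involutions, so this stability passes to the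
whole generated group, and every group element is its own product with the identity.\<close>

lemma VP_normal_form:
  assumes "g \<in> V\<^sub>P"
  shows "\<exists>B. normal_form B \<and> g = proj_class B"
proof -
  define N where "N = {proj_class B |B. normal_form B}"
  have N_carrier: "N \<subseteq> carrier PGL2"
    unfolding N_def using proj_class_carrier normal_form_det by blast
  have step: "proj_class R \<otimes>\<^bsub>PGL2\<^esub> x \<in> N" and invol: "inv\<^bsub>PGL2\<^esub> (proj_class R) = proj_class R"
    if det: "det R \<noteq> 0" and sq: "R ** R = mat 1"
      and stable: "\<And>B. normal_form B \<Longrightarrow> normal_form (R ** B)" and x: "x \<in> N" for R x
  proof -
    obtain B where B: "normal_form B" "x = proj_class B" using x unfolding N_def by blast
    have "proj_class R \<otimes>\<^bsub>PGL2\<^esub> x = proj_class (R ** B)"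
      using B det by (simp add: proj_class_mult normal_form_det)
    then show "proj_class R \<otimes>\<^bsub>PGL2\<^esub> x \<in> N"
      using stable[OF B(1)] unfolding N_def by blast
    show "inv\<^bsub>PGL2\<^esub> (proj_class R) = proj_class R"
      by (rule group.inv_equality[OF group_PGL2])
        (simp_all add: proj_class_mult proj_class_carrier det sq proj_class_one)
  qed
  have one: "\<one>\<^bsub>PGL2\<^esub> \<in> N"
    using normal_form_nu[of 0] unfolding N_def by (auto simp: proj_class_one nu_mat_0)
  have gen: "h \<in> carrier PGL2 \<and> (\<forall>x\<in>N. h \<otimes>\<^bsub>PGL2\<^esub> x \<in> N) \<and> inv\<^bsub>PGL2\<^esub> h = h"
    if h: "h \<in> {proj_class alpha_mat, proj_class beta_mat, proj_class gamma_mat}" for h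
  proof -
    have sq: "alpha_mat ** alpha_mat = mat 1" "beta_mat ** beta_mat = mat 1"
      by (simp_all add: alpha_mat_def beta_mat_def nu_mat_def mat2_eq_iff)
    note alpha = step[of alpha_mat, OF _ sq(1) normal_form_reflect_mult[OF nu_mult_refl(2)]]
      invol[of alpha_mat, OF _ sq(1) normal_form_reflect_mult[OF nu_mult_refl(2)] one]
    note beta = step[of beta_mat, OF _ sq(2) normal_form_reflect_mult[OF nu_mult_refl(1)]]
      invol[of beta_mat, OF _ sq(2) normal_form_reflect_mult[OF nu_mult_refl(1)] one]
    note gamma = step[of gamma_mat, OF _ gamma_gamma normal_form_gamma_mult]
      invol[of gamma_mat, OF _ gamma_gamma normal_form_gamma_mult one]
    show ?thesis
      using h by (elim insertE) (simp_all add: alpha beta gamma proj_class_carrier)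
  qed
  interpret group PGL2 by (rule group_PGL2)
  have closed: "g \<in> carrier PGL2 \<and> (\<forall>x\<in>N. g \<otimes>\<^bsub>PGL2\<^esub> x \<in> N)"
    using assms unfolding V\<^sub>P_def
  proof (induction rule: generate.induct)
    case one
    then show ?case using N_carrier by auto
  next
    case (incl h)
    then show ?case using gen by blast
  next
    case (inv h)
    then show ?case using gen[of h] by simp
  next
    case (eng h1 h2)
    have "h1 \<otimes>\<^bsub>PGL2\<^esub> h2 \<otimes>\<^bsub>PGL2\<^esub> x = h1 \<otimes>\<^bsub>PGL2\<^esub> (h2 \<otimes>\<^bsub>PGL2\<^esub> x)" if "x \<in> N" for x
      using eng that N_carrier by (intro m_assoc) auto
    then show ?case using eng by simp
  qed
  then have "g \<otimes>\<^bsub>PGL2\<^esub> \<one>\<^bsub>PGL2\<^esub> \<in> N" using one by blast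
  then show ?thesis using closed unfolding N_def by auto
qed

lemma VP_veech:
  assumes "g \<in> V\<^sub>P"
  shows "\<exists>A\<in>veech. g = proj_class A"
proof -
  obtain B where "normal_form B" "g = proj_class B" using VP_normal_form[OF assms] by blast
  then show ?thesis using assms normal_form_det[of B] by (auto simp: veech_def)
qed

lemma veech_normal_form:
  assumes "B \<in> veech"
  shows "normal_form B"
proof -
  obtain C where C: "normal_form C" "proj_class B = proj_class C"
    using assms VP_normal_form[of "proj_class B"] by (auto simp: veech_def)
  then show ?thesis using proj_class_eqD[OF C(2)] normal_form_scale by blast
qed

text \<open>The ping-pong: \<open>\<gamma>\<close> throws the whole half-plane in front of \<open>side0\<close> behind \<open>side0\<close>, and \<open>\<nu>\<^sub>k\<close> carries this
behind \<open>side k\<close>. For \<open>k \<noteq> 0\<close> the half-plane behind \<open>side k\<close> lies again in front of \<open>side0\<close>, so the next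
letter applies in the same way.\<close>

lemma word_ping_pong:
  assumes "A \<in> words" "Im z > 0" "wall_at (mat 1) z \<ge> 0"
  shows "\<exists>m\<le>7. wall_at (adj2 (nu_mat m)) (right_act z A) \<le> 0"
proof -
  have step: "wall_at (adj2 (nu_mat k)) (right_act z (gamma_mat ** nu_mat k)) \<le> 0"
    if "k \<le> 7" "Im z > 0" "wall_at (mat 1) z \<ge> 0" for k z
  proof -
    have d: "det (gamma_mat ** nu_mat k) \<noteq> 0" using that by (simp add: det_mul det_nu_nonzero)
    have "gamma_mat ** nu_mat k ** adj2 (nu_mat k) = det (nu_mat k) *\<^sub>R (mat 1 ** gamma_mat)"
      by (simp add: mult_adj2 scale_mult flip: matrix_mul_assoc)
    then have "wall_at (gamma_mat ** nu_mat k ** adj2 (nu_mat k)) z = (det (nu_mat k))\<^sup>2 * - wall_at (mat 1) z"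
      by (simp only: wall_form_scale wall_form_gamma)
    then have "\<not> wall_at (gamma_mat ** nu_mat k ** adj2 (nu_mat k)) z > 0"
      using that(3) by (simp add: not_less)
    then show ?thesis
      using wall_at_right_act_sign(3)[OF that(2) d] by (meson not_less)
  qed
  show ?thesis
    using assms
  proof (induction A arbitrary: z rule: words.induct)
    case (single k)
    then show ?case using step by blast
  next
    case (snoc k A)
    let ?y = "right_act z (gamma_mat ** nu_mat k)"
    have d: "det (gamma_mat ** nu_mat k) \<noteq> 0" using snoc by (simp add: det_mul det_nu_nonzero)
    have y: "Im ?y > 0" using Im_right_act_pos[OF _ d] snoc by blast
    have "wall_at (adj2 (nu_mat k)) ?y \<le> 0" using step snoc by blast
    moreover have "wall_at (adj2 (nu_mat 0)) ?y + wall_at (adj2 (nu_mat k)) ?y > 0"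
      using translated_walls_apart_at[of 0 k ?y "mat 1"] snoc y by simp
    moreover have "adj2 (nu_mat 0) = mat 1" by (simp add: nu_mat_0 mat2_eq_iff)
    ultimately have "wall_at (mat 1) ?y \<ge> 0" by simp
    then have "\<exists>m\<le>7. wall_at (adj2 (nu_mat m)) (right_act ?y A) \<le> 0"
      using snoc.IH y by blast
    then show ?case
      using right_act_mult[OF snoc.prems(1) d words_det[OF snoc.hyps(3)]] by simp
  qed
qed

text \<open>The \<open>\<nu>\<^sub>i\<close> form the dihedral symmetry group of the octagon, up to sign.\<close>

lemma nu_mult:
  assumes "i \<le> 7" "j \<le> 7"
  shows "\<exists>m\<le>7. \<exists>c\<noteq>0. nu_mat i ** nu_mat j = c *\<^sub>R nu_mat m"
proof -
  let ?S = "{A. \<forall>j\<le>7. \<exists>m\<le>7. \<exists>c\<noteq>0. A ** nu_mat j = c *\<^sub>R nu_mat m}"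
  have pm: "\<exists>c\<noteq>0. X = c *\<^sub>R Y" if "X = Y \<or> X = - Y" for X Y :: "real^2^2"
    using that by (metis scaleR_minus_left scaleR_one neg_equal_0_iff_equal zero_neq_one)
  have "nu_mat i \<in> ?S"
  proof (rule nu_generated[OF assms(1)])
    show "beta_mat \<in> ?S" "alpha_mat \<in> ?S"
      using nu_mult_refl pm by blast+
    show "mat 1 \<in> ?S" using pm by fastforce
    show "A ** B \<in> ?S" if A: "A \<in> ?S" and B: "B \<in> ?S" for A B
    proof (clarify)
      fix j :: nat assume "j \<le> 7"
      then obtain m c where m: "m \<le> 7" "c \<noteq> 0" "B ** nu_mat j = c *\<^sub>R nu_mat m"
        using B by blast
      then obtain n d where n: "n \<le> 7" "d \<noteq> 0" "A ** nu_mat m = d *\<^sub>R nu_mat n"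
        using A by blast
      have "A ** B ** nu_mat j = (c * d) *\<^sub>R nu_mat n"
        using m n by (simp add: scale_mult flip: matrix_mul_assoc)
      then show "\<exists>n\<le>7. \<exists>c\<noteq>0. A ** B ** nu_mat j = c *\<^sub>R nu_mat n"
        using m n by (metis no_zero_divisors)
    qed
  qed
  then show ?thesis using assms(2) by blast
qed

lemma adj2_nu:
  assumes "i \<le> 7"
  shows "\<exists>m\<le>7. \<exists>c\<noteq>0. adj2 (nu_mat i) = c *\<^sub>R nu_mat m"
proof -
  have "adj2 (nu_mat i) = det (nu_mat i) *\<^sub>R nu_mat ([0,1,6,3,4,5,2,7] ! i)
      \<or> adj2 (nu_mat i) = - det (nu_mat i) *\<^sub>R nu_mat ([0,1,6,3,4,5,2,7] ! i)"
    using assms by (rule le_7_cases)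
      (simp_all add: nu_mat_def mat2_eq_iff numeral_eq_Suc)
  moreover have "[0,1,6,3,4,5,2,7] ! i \<le> (7::nat)"
    using assms by (rule le_7_cases) simp_all
  ultimately show ?thesis
    using det_nu_nonzero[OF assms] by (metis neg_equal_0_iff_equal)
qed

text \<open>The group of symmetries permutes the eight walls, and the octagon is cut out by all of them.\<close>

lemma octagon_subset_img_nu:
  assumes "j \<le> 7"
  shows "octagon \<subseteq> img (nu_mat j) octagon"
proof
  fix z assume z: "z \<in> octagon"
  have "wall_at (adj2 (nu_mat j) ** adj2 (nu_mat i)) z \<ge> 0" if i: "i \<le> 7" for i
  proof -
    obtain m c where m: "m \<le> 7" "nu_mat i ** nu_mat j = c *\<^sub>R nu_mat m"
      using nu_mult[OF i assms] by blast
    have "adj2 (nu_mat j) ** adj2 (nu_mat i) = c *\<^sub>R adj2 (nu_mat m)"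
      using m(2) by (metis adj2_mult adj2_scale)
    then show ?thesis
      using z m(1) by (simp add: wall_form_scale octagon_iff)
  qed
  then show "z \<in> img (nu_mat j) octagon"
    using z assms by (simp add: img_octagon_iff det_nu_nonzero octagon_iff)
qed

lemma img_nu_octagon:
  assumes "j \<le> 7"
  shows "img (nu_mat j) octagon = octagon"
proof
  obtain m c where m: "m \<le> 7" "c \<noteq> 0" "adj2 (nu_mat j) = c *\<^sub>R nu_mat m"
    using adj2_nu[OF assms] by blast
  have "octagon \<subseteq> img (adj2 (nu_mat j)) octagon"
    using octagon_subset_img_nu[OF m(1)] m(2,3) by (simp add: img_scale)
  then have "img (nu_mat j) octagon \<subseteq> img (nu_mat j) (img (adj2 (nu_mat j)) octagon)"
    unfolding img_def by (rule image_mono)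
  also have "\<dots> = octagon"
    using assms by (simp add: img_mult[OF octagon_upper] det_nu_nonzero mult_adj2 img_scale img_one)
  finally show "img (nu_mat j) octagon \<subseteq> octagon" .
qed (rule octagon_subset_img_nu[OF assms])

lemma nu_side:
  assumes "i \<le> 7" "j \<le> 7"
  shows "\<exists>m\<le>7. img (nu_mat j) (side i) = side m"
proof -
  obtain m c where m: "m \<le> 7" "c \<noteq> 0" "nu_mat i ** nu_mat j = c *\<^sub>R nu_mat m"
    using nu_mult[OF assms] by blast
  have "img (nu_mat j) (side i) = img (nu_mat i ** nu_mat j) side0"
    unfolding side_img using assms by (simp add: img_mult[OF side0_upper] det_nu_nonzero)
  then show ?thesis using m by (auto simp: img_scale side_img)
qed

text \<open>A normal form that contains a letter \<open>\<gamma>\<close> would move \<open>z\<close> behind some side.\<close>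

lemma veech_interior_imp_nu:
  assumes "A \<in> veech" "z \<in> octagon" "\<And>m. m \<le> 7 \<Longrightarrow> wall_at (adj2 (nu_mat m)) (right_act z A) > 0"
  shows "\<exists>j\<le>7. \<exists>c\<noteq>0. A = c *\<^sub>R nu_mat j"
proof (rule ccontr)
  assume "\<not> ?thesis"
  then obtain j c B where B: "j \<le> 7" "c \<noteq> 0" "B \<in> words" "A = c *\<^sub>R (nu_mat j ** B)"
    using veech_normal_form[OF assms(1)] unfolding normal_form_def by blast
  let ?y = "right_act z (nu_mat j)"
  have y: "?y \<in> octagon"
    using img_nu_octagon[OF B(1)] assms(2) unfolding img_def by blast
  have "adj2 (nu_mat 0) = mat 1" by (simp add: nu_mat_0 mat2_eq_iff)
  then have "Im ?y > 0" "wall_at (mat 1) ?y \<ge> 0"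
    using y unfolding octagon_iff by (auto dest!: spec[of _ "0::nat"])
  then obtain m where "m \<le> 7" "wall_at (adj2 (nu_mat m)) (right_act ?y B) \<le> 0"
    using word_ping_pong[OF B(3)] by blast
  moreover have "right_act ?y B = right_act z A"
    using B assms(2) by (simp add: right_act_scale right_act_mult octagon_iff det_nu_nonzero words_det)
  ultimately show False using assms(3)[of m] by auto
qed

lemma wall_nu_ii:
  assumes "i \<le> 7"
  shows "wall_at (adj2 (nu_mat i)) \<i> > 0"
  using wall_nu[OF assms, of 1 0 1] by simp

lemma ii_octagon: "\<i> \<in> octagon"
  using wall_nu_ii by (auto simp: octagon_iff intro: less_imp_le)

text \<open>Tiles have disjoint interiors: the assumption says that \<open>z\<close> lies in the interior of \<open>octagon A\<close>.
Transporting both tiles by \<open>A\<inverse>\<close> reduces this to the octagon itself.\<close>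

lemma tile_interior_unique:
  assumes "A \<in> veech" "B \<in> veech" "z \<in> img B octagon"
    and "\<And>m. m \<le> 7 \<Longrightarrow> wall_at (adj2 A ** adj2 (nu_mat m)) z > 0"
  shows "\<exists>j\<le>7. \<exists>c\<noteq>0. B = c *\<^sub>R (nu_mat j ** A)"
proof -
  obtain y where y: "y \<in> octagon" "z = right_act y B" using assms(3) by (auto simp: img_def)
  have d: "det A \<noteq> 0" "det B \<noteq> 0" using assms veech_det by blast+
  have z: "Im z > 0" using y d Im_right_act_pos octagon_upper by auto
  have "right_act y (B ** adj2 A) = right_act z (adj2 A)"
    using y d octagon_upper by (auto simp: right_act_mult)
  moreover have "wall_at (adj2 (nu_mat m)) (right_act z (adj2 A)) > 0" if "m \<le> 7" for m
    using wall_at_right_act_sign(3)[of z "adj2 A" "adj2 (nu_mat m)"] z d assms(4)[OF that] by simp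
  ultimately obtain j c where j: "j \<le> 7" "c \<noteq> 0" "B ** adj2 A = c *\<^sub>R nu_mat j"
    using veech_interior_imp_nu[of "B ** adj2 A" y] assms(1,2) y(1)
    by (auto simp: veech_mult veech_adj2)
  have "det A *\<^sub>R B = B ** adj2 A ** A"
    by (simp add: mult_adj2 scale_mult flip: matrix_mul_assoc)
  also have "\<dots> = c *\<^sub>R (nu_mat j ** A)" by (simp add: j scale_mult)
  finally have "B = (c / det A) *\<^sub>R (nu_mat j ** A)"
    using d by (metis (no_types, opaque_lifting) divide_inverse mult.commute scaleR_scaleR left_inverse scaleR_one)
  then show ?thesis using j d by (metis divide_eq_0_iff)
qed

text \<open>The image of the centre \<open>\<i>\<close> is an interior point of the tile, and no other tile meets the interior.\<close>

lemma img_octagon_eqD: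
  assumes "A \<in> veech" "B \<in> veech" "img B octagon = img A octagon"
  shows "\<exists>j\<le>7. \<exists>c\<noteq>0. B = c *\<^sub>R (nu_mat j ** A)"
proof (rule tile_interior_unique[OF assms(1,2)])
  let ?z = "right_act \<i> A"
  show "?z \<in> img B octagon" using assms(3) ii_octagon by (auto simp: img_def)
  have d: "det A \<noteq> 0" using assms veech_det by blast
  fix m :: nat assume m: "m \<le> 7"
  have "wall_at (adj2 (nu_mat m)) (right_act ?z (adj2 A)) > 0"
    using wall_nu_ii[OF m] d by (simp add: right_act_adj2)
  then show "wall_at (adj2 A ** adj2 (nu_mat m)) ?z > 0"
    using wall_at_right_act_sign(3)[of ?z "adj2 A" "adj2 (nu_mat m)"] d Im_right_act_pos[of \<i> A] by simp
qed

lemma img_nu_mult_octagon: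
  assumes "det A \<noteq> 0" "j \<le> 7"
  shows "img (nu_mat j ** A) octagon = img A octagon"
  using img_mult[OF octagon_upper det_nu_nonzero[OF assms(2)] assms(1)] img_nu_octagon[OF assms(2)] by simp

lemma tiles_iff: "T \<in> tiles \<longleftrightarrow> (\<exists>A\<in>veech. T = img A octagon)"
proof
  assume "T \<in> tiles"
  then obtain g where g: "g \<in> V\<^sub>P" "T = proj_image octagon g" by (auto simp: tiles_def)
  obtain A where "A \<in> veech" "g = proj_class A" using VP_veech[OF g(1)] by blast
  then show "\<exists>A\<in>veech. T = img A octagon"
    using g(2) by (auto simp: proj_image_class veech_det)
next
  assume "\<exists>A\<in>veech. T = img A octagon"
  then obtain A where "A \<in> veech" "T = img A octagon" by blast
  then have "proj_class A \<in> V\<^sub>P" "T = proj_image octagon (proj_class A)"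
    by (simp_all add: veech_def proj_image_class)
  then show "T \<in> tiles" unfolding tiles_def by blast
qed

text \<open>The sides of a tile do not depend on the group element used to describe it, because the stabilizer of
the octagon permutes the sides of the octagon.\<close>

lemma is_side_of_img:
  assumes "A \<in> veech"
  shows "is_side_of E (img A octagon) \<longleftrightarrow> (\<exists>i\<le>7. E = img A (side i))"
proof
  have d: "det A \<noteq> 0" using assms veech_det by blast
  assume "is_side_of E (img A octagon)"
  then obtain g i where g: "g \<in> V\<^sub>P" "i \<le> 7" "img A octagon = proj_image octagon g" "E = proj_image (side i) g"
    by (auto simp: is_side_of_def)
  obtain B where B: "B \<in> veech" "g = proj_class B" using VP_veech g(1) by blast
  then have eqs: "img B octagon = img A octagon" "E = img B (side i)"
    using g veech_det[OF B(1)] by (simp_all add: proj_image_class)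
  then obtain j c where j: "j \<le> 7" "c \<noteq> 0" "B = c *\<^sub>R (nu_mat j ** A)"
    using img_octagon_eqD[OF assms B(1)] by blast
  have "E = img A (img (nu_mat j) (side i))"
    using j eqs g(2) d by (simp add: img_scale img_mult[OF side_upper] det_nu_nonzero)
  then show "\<exists>i\<le>7. E = img A (side i)" using nu_side[OF g(2) j(1)] by metis
next
  assume "\<exists>i\<le>7. E = img A (side i)"
  then obtain i where i: "i \<le> 7" "E = img A (side i)" by blast
  moreover have "proj_class A \<in> V\<^sub>P" "img A octagon = proj_image octagon (proj_class A)"
    "img A (side i) = proj_image (side i) (proj_class A)"
    using assms by (simp_all add: veech_def proj_image_class)
  moreover have "i \<in> {0..7}" using i by simp
  ultimately show "is_side_of E (img A octagon)"
    unfolding is_side_of_def by blast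
qed

text \<open>Uniqueness holds because the symmetries act freely on the sides of the octagon: only \<open>\<nu>\<^sub>0\<close> preserves
\<open>side0\<close>.\<close>

lemma normalizing_elem_img:
  assumes "A \<in> veech"
  shows "normalizing_elem (img A octagon) (img A side0) = proj_class (adj2 A)"
  unfolding normalizing_elem_def
proof (rule the_equality)
  have d: "det A \<noteq> 0" using assms veech_det by blast
  have cancel: "img (adj2 A) (img A X) = X" if "X \<subseteq> {z. Im z > 0}" for X
    using d by (simp add: img_mult[OF that] mult_adj2 img_scale img_one)
  show "proj_class (adj2 A) \<in> V\<^sub>P \<and> proj_image (img A octagon) (proj_class (adj2 A)) = octagon \<and>
      proj_image (img A side0) (proj_class (adj2 A)) = side0"
    using assms d veech_adj2[OF assms]
    by (simp add: veech_def proj_image_class cancel octagon_upper side0_upper)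
  fix g assume g: "g \<in> V\<^sub>P \<and> proj_image (img A octagon) g = octagon \<and> proj_image (img A side0) g = side0"
  then obtain B where B: "B \<in> veech" "g = proj_class B" using VP_veech by blast
  have dB: "det B \<noteq> 0" using B veech_det by blast
  have "img (A ** B) octagon = img (mat 1) octagon" "img (A ** B) side0 = side0"
    using g B dB d by (simp_all add: proj_image_class img_mult octagon_upper side0_upper img_one)
  then obtain j c where j: "j \<le> 7" "c \<noteq> 0" "A ** B = c *\<^sub>R nu_mat j"
    using img_octagon_eqD[OF veech_one veech_mult[OF assms B(1)]] by auto
  have "img (mat 1) (side j) = img (mat 1) (side 0)"
    using \<open>img (A ** B) side0 = side0\<close> j by (simp add: img_scale side_0 img_one flip: side_img)
  then have "j = 0" using img_side_inject[of "mat 1" j 0] j(1) by simp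
  have "det A *\<^sub>R B = adj2 A ** (A ** B)"
    by (simp add: mult_adj2 scale_mult matrix_mul_assoc)
  also have "\<dots> = c *\<^sub>R adj2 A"
    using j \<open>j = 0\<close> by (simp add: scale_mult nu_mat_0)
  finally have "proj_class (det A *\<^sub>R B) = proj_class (c *\<^sub>R adj2 A)" by simp
  then show "g = proj_class (adj2 A)"
    using B(2) d j(2) by (simp add: proj_class_scale)
qed

section \<open>Walls along the ray\<close>

text \<open>The values of a wall form at the forward endpoint \<open>- tan \<theta> = sin \<theta> / (- cos \<theta>)\<close> of the ray and at the
endpoint \<open>cot \<theta> = cos \<theta> / sin \<theta>\<close> of its backward extension.\<close>

definition fwd :: "real \<Rightarrow> real^2^2 \<Rightarrow> real" where
  "fwd \<theta> A = wall_form A ((sin \<theta>)\<^sup>2) (sin \<theta> * - cos \<theta>) ((- cos \<theta>)\<^sup>2)"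

definition bwd :: "real \<Rightarrow> real^2^2 \<Rightarrow> real" where
  "bwd \<theta> A = wall_form A ((cos \<theta>)\<^sup>2) (cos \<theta> * sin \<theta>) ((sin \<theta>)\<^sup>2)"

definition along :: "real \<Rightarrow> real^2^2 \<Rightarrow> real \<Rightarrow> real" where
  "along \<theta> A t = exp t * fwd \<theta> A + exp (- t) * bwd \<theta> A"

text \<open>The triple \<open>(\<bar>z\<bar>\<^sup>2, Re z, 1)\<close> of a point of the ray is, up to a positive factor, the combination of the
triples of the two endpoints with weights \<open>e\<^sup>t\<close> and \<open>e\<^sup>-\<^sup>t\<close>, and the wall form is linear in it.\<close>

lemma wall_at_ray: "\<exists>D>0. wall_at A (teich_ray \<theta> t) = D * along \<theta> A t"
proof -
  define e where "e = exp t"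
  define q where "q = (sin \<theta>)\<^sup>2 + (e * cos \<theta>)\<^sup>2"
  have e: "e > 0" "exp (- t) = 1 / e" by (simp_all add: e_def exp_minus field_simps)
  have q: "q > 0" unfolding q_def e_def by (rule teich_ray_denom_pos)
  define n where "n = complex_of_real (cos \<theta>) + \<i> * of_real (e * sin \<theta>)"
  define d where "d = complex_of_real (sin \<theta>) - \<i> * of_real (e * cos \<theta>)"
  have z: "teich_ray \<theta> t = n / d" unfolding teich_ray_eq n_def d_def e_def ..
  have d: "(cmod d)\<^sup>2 = q" by (simp add: d_def q_def cmod_power2)
  have n: "(cmod n)\<^sup>2 = (cos \<theta>)\<^sup>2 + e\<^sup>2 * (sin \<theta>)\<^sup>2"
    by (simp add: n_def cmod_power2 power_mult_distrib)
  have abs: "(cmod (teich_ray \<theta> t))\<^sup>2 = e / q * (e * (sin \<theta>)\<^sup>2 + 1 / e * (cos \<theta>)\<^sup>2)"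
    using e(1) q unfolding z norm_divide power_divide d n
    by (simp add: power2_eq_square field_simps)
  have re: "Re (teich_ray \<theta> t) = e / q * (e * (sin \<theta> * - cos \<theta>) + 1 / e * (cos \<theta> * sin \<theta>))"
    using e(1) q unfolding z Re_divide d[unfolded cmod_power2]
    by (simp add: n_def d_def power2_eq_square field_simps)
  have one: "1 = e / q * (e * (- cos \<theta>)\<^sup>2 + 1 / e * (sin \<theta>)\<^sup>2)"
  proof -
    have "e * (e * (- cos \<theta>)\<^sup>2 + 1 / e * (sin \<theta>)\<^sup>2) = q"
      using e(1) by (simp add: q_def power_mult_distrib power2_eq_square field_simps)
    then show ?thesis using q by (simp add: field_simps)
  qed
  have "wall_at A (teich_ray \<theta> t) = e / q * along \<theta> A t"
    unfolding abs re along_def fwd_def bwd_def e(2) e_def[symmetric]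
    by (subst one) (simp only: wall_form_linear)
  moreover have "e / q > 0" using e q by simp
  ultimately show ?thesis by blast
qed

lemma wall_at_ray_sign:
  "wall_at A (teich_ray \<theta> t) \<ge> 0 \<longleftrightarrow> along \<theta> A t \<ge> 0"
  "wall_at A (teich_ray \<theta> t) = 0 \<longleftrightarrow> along \<theta> A t = 0"
  "wall_at A (teich_ray \<theta> t) > 0 \<longleftrightarrow> along \<theta> A t > 0"
  using wall_at_ray[of A \<theta> t] by (auto simp: zero_le_mult_iff zero_less_mult_iff)

text \<open>The zero of \<open>e\<^sup>t P + e\<^sup>-\<^sup>t R\<close> for \<open>P < 0 < R\<close>.\<close>

definition crossing_time :: "real \<Rightarrow> real^2^2 \<Rightarrow> real" where
  "crossing_time \<theta> A = ln (bwd \<theta> A / - fwd \<theta> A) / 2"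

lemma along_crossing:
  assumes "fwd \<theta> A < 0" "bwd \<theta> A > 0"
  shows "along \<theta> A t \<ge> 0 \<longleftrightarrow> t \<le> crossing_time \<theta> A"
    and "along \<theta> A t = 0 \<longleftrightarrow> t = crossing_time \<theta> A"
    and "along \<theta> A t > 0 \<longleftrightarrow> t < crossing_time \<theta> A"
proof -
  define u where "u = crossing_time \<theta> A"
  have pos: "bwd \<theta> A / - fwd \<theta> A > 0" using assms by (simp add: divide_pos_neg)
  have "exp u * exp u = exp (ln (bwd \<theta> A / - fwd \<theta> A))"
    by (simp add: u_def crossing_time_def flip: exp_add)
  also have "\<dots> = bwd \<theta> A / - fwd \<theta> A" using pos by (rule exp_ln)
  finally have b: "bwd \<theta> A = - fwd \<theta> A * (exp u * exp u)" using assms by (simp add: field_simps)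
  define K where "K = - fwd \<theta> A * exp u"
  have eq: "along \<theta> A t = K * (exp (u - t) - exp (t - u))"
    unfolding along_def b K_def by (simp add: exp_diff exp_minus field_simps)
  have c: "K > 0" using assms by (simp add: K_def mult_neg_pos)
  show "along \<theta> A t \<ge> 0 \<longleftrightarrow> t \<le> crossing_time \<theta> A"
    "along \<theta> A t = 0 \<longleftrightarrow> t = crossing_time \<theta> A"
    "along \<theta> A t > 0 \<longleftrightarrow> t < crossing_time \<theta> A"
    using c unfolding eq u_def[symmetric] zero_le_mult_iff zero_less_mult_iff mult_eq_0_iff
    by auto
qed

lemma endpoint_walls_apart:
  assumes "i \<le> 7" "j \<le> 7" "i \<noteq> j"
  shows "fwd \<theta> (A ** adj2 (nu_mat i)) + fwd \<theta> (A ** adj2 (nu_mat j)) \<ge> 0"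
    and "bwd \<theta> (A ** adj2 (nu_mat i)) + bwd \<theta> (A ** adj2 (nu_mat j)) \<ge> 0"
  unfolding fwd_def bwd_def
  by (rule translated_walls_apart(1)[OF assms]; simp add: power_mult_distrib)+

text \<open>The \<open>l\<close>-th tile is \<open>octagon\<close> moved by this matrix. Acting on directions from the left it is also the
composition of the first \<open>l\<close> Farey branches.\<close>

primrec tile_mat :: "(nat \<Rightarrow> nat) \<Rightarrow> nat \<Rightarrow> real^2^2" where
  "tile_mat s 0 = mat 1"
| "tile_mat s (Suc l) = gamma_mat ** nu_mat (s l) ** tile_mat s l"

text \<open>The matrix whose wall form belongs to the \<open>i\<close>-th side of the \<open>l\<close>-th tile; the form is positive in the interior of the tile.\<close>

abbreviation wall_mat :: "(nat \<Rightarrow> nat) \<Rightarrow> nat \<Rightarrow> nat \<Rightarrow> real^2^2" where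
  "wall_mat s l i \<equiv> adj2 (tile_mat s l) ** adj2 (nu_mat i)"

definition exit_time :: "real \<Rightarrow> (nat \<Rightarrow> nat) \<Rightarrow> nat \<Rightarrow> real" where
  "exit_time \<theta> s l = crossing_time \<theta> (wall_mat s l (s l))"

text \<open>The ray starts inside the octagon, whose traversal is counted from time \<open>0\<close>.\<close>

definition entry_time :: "real \<Rightarrow> (nat \<Rightarrow> nat) \<Rightarrow> nat \<Rightarrow> real" where
  "entry_time \<theta> s l = (if l = 0 then 0 else exit_time \<theta> s (l - 1))"

lemma adj2_one: "adj2 (mat 1) = mat 1"
  by (simp add: mat2_eq_iff)

lemma adj2_gamma: "adj2 gamma_mat = (-1) *\<^sub>R gamma_mat"
  by (simp add: gamma_mat_def mat2_eq_iff)

lemma wall_mat_Suc_0: "wall_mat s (Suc l) 0 = (-1) *\<^sub>R (wall_mat s l (s l) ** gamma_mat)"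
  by (simp only: tile_mat.simps adj2_mult adj2_gamma nu_mat_0 adj2_one matrix_mul_rid scale_mult
      matrix_mul_assoc)

text \<open>The exit side of a tile is the entry side of the next one, seen from the other side.\<close>

lemma wall_form_wall_mat_Suc_0: "wall_form (wall_mat s (Suc l) 0) m x w = - wall_form (wall_mat s l (s l)) m x w"
  unfolding wall_mat_Suc_0 wall_form_scale wall_form_gamma by simp

lemma fwd_Suc_0: "fwd \<theta> (wall_mat s (Suc l) 0) = - fwd \<theta> (wall_mat s l (s l))"
  and bwd_Suc_0: "bwd \<theta> (wall_mat s (Suc l) 0) = - bwd \<theta> (wall_mat s l (s l))"
  and along_Suc_0: "along \<theta> (wall_mat s (Suc l) 0) t = - along \<theta> (wall_mat s l (s l)) t"
  unfolding along_def fwd_def bwd_def wall_form_wall_mat_Suc_0 by simp_all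

text \<open>The direction points, in the coordinates of the \<open>l\<close>-th tile, through the interior of its side \<open>s l\<close>.\<close>

definition itinerary :: "real \<Rightarrow> (nat \<Rightarrow> nat) \<Rightarrow> bool" where
  "itinerary \<theta> s \<longleftrightarrow> (\<forall>l. s l \<le> 7) \<and> (\<forall>l. s (Suc l) \<noteq> 0) \<and> (\<forall>l. fwd \<theta> (wall_mat s l (s l)) < 0)"

context
  fixes \<theta> :: real and s :: "nat \<Rightarrow> nat"
  assumes itinerary: "itinerary \<theta> s"
begin

lemma le7: "s l \<le> 7" and nonzero: "s (Suc l) \<noteq> 0" and fwd_neg: "fwd \<theta> (wall_mat s l (s l)) < 0"
  using itinerary by (auto simp: itinerary_def)

text \<open>The forward endpoint can lie behind only one side of each tile.\<close>

lemma fwd_pos: "i \<le> 7 \<Longrightarrow> i \<noteq> s l \<Longrightarrow> fwd \<theta> (wall_mat s l i) > 0"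
  using endpoint_walls_apart(1)[OF le7[of l], of i \<theta> "adj2 (tile_mat s l)"] fwd_neg[of l] by simp

lemma along_start: "i \<le> 7 \<Longrightarrow> along \<theta> (wall_mat s 0 i) 0 > 0"
  using wall_at_ray_sign(3)[of "wall_mat s 0 i" \<theta> 0] wall_nu_ii[of i] by (simp add: teich_ray_0 adj2_one)

text \<open>The backward endpoint does not lie behind the exit side. For the octagon itself, \<open>\<i>\<close> is in front of
that side while the forward endpoint is behind it. For later tiles the backward endpoint is behind
the entry side \<open>0\<close>, which is different from the exit side because \<open>s\<close> does not vanish there.\<close>

lemma bwd_pos: "bwd \<theta> (wall_mat s l (s l)) > 0"
proof (induction l)
  case 0
  then show ?case using along_start[OF le7[of 0]] fwd_neg[of 0] by (simp add: along_def)
next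
  case (Suc l)
  then show ?case
    using endpoint_walls_apart(2)[of 0 "s (Suc l)" \<theta> "adj2 (tile_mat s (Suc l))"] nonzero[of l] le7[of "Suc l"]
      bwd_Suc_0[of \<theta> s l] by linarith
qed

lemma bwd_Suc_pos: "i \<le> 7 \<Longrightarrow> i \<noteq> 0 \<Longrightarrow> bwd \<theta> (wall_mat s (Suc l) i) > 0"
  using endpoint_walls_apart(2)[of 0 i \<theta> "adj2 (tile_mat s (Suc l))"] bwd_pos[of l] bwd_Suc_0[of \<theta> s l]
  by linarith

lemmas along_exit = along_crossing[OF fwd_neg bwd_pos, folded exit_time_def]

lemma tile_mat_veech: "tile_mat s l \<in> veech"
  by (induction l) (simp_all add: veech_one veech_mult veech_generators veech_nu le7)

lemma tile_mat_det: "det (tile_mat s l) \<noteq> 0"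
  by (rule veech_det[OF tile_mat_veech])

lemma exit_time_0_pos: "exit_time \<theta> s 0 > 0"
  using along_exit(3)[of 0 0] along_start[OF le7] by simp

text \<open>At the moment of entering, the ray is on the wall \<open>0\<close> of the tile, hence strictly in front of every
other wall.\<close>

lemma exit_time_less: "exit_time \<theta> s l < exit_time \<theta> s (Suc l)"
proof -
  let ?t = "exit_time \<theta> s l" and ?A = "adj2 (tile_mat s (Suc l))"
  have "along \<theta> (wall_mat s (Suc l) 0) ?t = 0"
    by (simp only: along_Suc_0 along_exit neg_equal_0_iff_equal)
  then have "wall_at (wall_mat s (Suc l) 0) (teich_ray \<theta> ?t) = 0"
    by (simp only: wall_at_ray_sign)
  moreover have "wall_at (wall_mat s (Suc l) 0) (teich_ray \<theta> ?t) + wall_at (wall_mat s (Suc l) (s (Suc l))) (teich_ray \<theta> ?t) > 0"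
    using nonzero[of l] le7[of "Suc l"] tile_mat_det[of "Suc l"]
    by (intro translated_walls_apart_at Im_teich_ray_pos) (simp_all only: det_adj2, simp_all)
  ultimately have "along \<theta> (wall_mat s (Suc l) (s (Suc l))) ?t > 0"
    using wall_at_ray_sign(3) by simp
  then show ?thesis by (simp only: along_exit)
qed

lemma exit_time_pos: "exit_time \<theta> s l > 0"
  by (induction l) (use exit_time_0_pos exit_time_less in \<open>auto intro: less_trans\<close>)

lemma entry_time_nonneg: "entry_time \<theta> s l \<ge> 0"
  using exit_time_pos by (simp add: entry_time_def less_imp_le)

lemma entry_time_less: "entry_time \<theta> s l < exit_time \<theta> s l"
  using exit_time_0_pos exit_time_less by (cases l) (simp_all add: entry_time_def)

text \<open>The sides other than the entry and exit sides are never met. In the octagon there is no entry side,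
and for these sides only the position of the starting point and of the forward endpoint are known;
that is enough for nonnegative times.\<close>

lemma along_other_pos:
  assumes "t \<ge> 0" "i \<le> 7" "i \<noteq> s l" "l = 0 \<or> i \<noteq> 0"
  shows "along \<theta> (wall_mat s l i) t > 0"
proof (cases l)
  case 0
  have "0 < exp (- t) * (fwd \<theta> (wall_mat s l i) + bwd \<theta> (wall_mat s l i))"
    using along_start[OF assms(2)] 0 by (simp add: along_def)
  also have "\<dots> \<le> along \<theta> (wall_mat s l i) t"
    using assms(1) fwd_pos[OF assms(2,3)] by (simp add: along_def distrib_left mult_right_mono)
  finally show ?thesis .
next
  case (Suc m)
  then show ?thesis
    using fwd_pos[OF assms(2,3)] bwd_Suc_pos[OF assms(2), of m] assms(4)
    by (simp add: along_def add_pos_pos)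
qed

lemma along_entry:
  "along \<theta> (wall_mat s (Suc l) 0) t \<ge> 0 \<longleftrightarrow> entry_time \<theta> s (Suc l) \<le> t"
  "along \<theta> (wall_mat s (Suc l) 0) t > 0 \<longleftrightarrow> entry_time \<theta> s (Suc l) < t"
  using along_exit(1,3)[of l t] by (auto simp only: along_Suc_0 entry_time_def) auto

lemma interior_times:
  assumes "entry_time \<theta> s l < t" "t < exit_time \<theta> s l" "i \<le> 7"
  shows "along \<theta> (wall_mat s l i) t > 0"
proof -
  have "t \<ge> 0" using assms(1) entry_time_nonneg[of l] by linarith
  then show ?thesis
    using along_other_pos[OF _ assms(3), of t l] along_exit(3)[of l t] along_entry(2)[of _ t] assms
    by (cases "i = s l"; cases l; cases "i = 0") auto
qed

lemma tile_times:
  assumes "t \<ge> 0"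
  shows "teich_ray \<theta> t \<in> img (tile_mat s l) octagon \<longleftrightarrow> entry_time \<theta> s l \<le> t \<and> t \<le> exit_time \<theta> s l"
proof -
  have "teich_ray \<theta> t \<in> img (tile_mat s l) octagon \<longleftrightarrow> (\<forall>i\<le>7. along \<theta> (wall_mat s l i) t \<ge> 0)"
    by (simp add: img_octagon_iff tile_mat_det Im_teich_ray_pos wall_at_ray_sign)
  also have "\<dots> \<longleftrightarrow> entry_time \<theta> s l \<le> t \<and> t \<le> exit_time \<theta> s l"
  proof (intro iffI allI impI conjI)
    assume *: "\<forall>i\<le>7. along \<theta> (wall_mat s l i) t \<ge> 0"
    show "entry_time \<theta> s l \<le> t"
      using *[rule_format, of 0] along_entry(1)[of _ t] assms by (cases l) (simp_all add: entry_time_def)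
    show "t \<le> exit_time \<theta> s l" using *[rule_format, OF le7[of l]] along_exit(1) by simp
  next
    fix i :: nat assume *: "entry_time \<theta> s l \<le> t \<and> t \<le> exit_time \<theta> s l" "i \<le> 7"
    show "along \<theta> (wall_mat s l i) t \<ge> 0"
      using along_other_pos[OF assms *(2), of l] along_exit(1)[of l t] along_entry(1)[of _ t] *
      by (cases "i = s l"; cases l; cases "i = 0") auto
  qed
  finally show ?thesis .
qed

lemma tile_traversed: "traverses (teich_ray \<theta>) (img (tile_mat s l) octagon) (entry_time \<theta> s l) (exit_time \<theta> s l)"
  unfolding traverses_def tiles_iff
  using tile_mat_veech entry_time_less tile_times entry_time_nonneg[of l]
  by (auto intro: order_trans)

text \<open>The two time intervals start at the same moment, so some common time lies in the interior of the
\<open>l\<close>-th tile, which no other tile meets.\<close>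

lemma traversed_unique:
  assumes "traverses (teich_ray \<theta>) T (entry_time \<theta> s l) c"
  shows "T = img (tile_mat s l) octagon \<and> c = exit_time \<theta> s l"
proof -
  let ?a = "entry_time \<theta> s l" and ?b = "exit_time \<theta> s l"
  obtain B where B: "B \<in> veech" "T = img B octagon"
    using assms by (auto simp: traverses_def tiles_iff)
  \<comment> \<open>A time in the interior of both intervals.\<close>
  define t where "t = (?a + min ?b c) / 2"
  have t: "?a < t" "t < ?b" "t \<le> c"
    using assms entry_time_less[of l] by (auto simp: t_def traverses_def min_def)
  then have "t \<in> {t. 0 \<le> t \<and> teich_ray \<theta> t \<in> T}"
    using assms unfolding traverses_def by simp
  then have "teich_ray \<theta> t \<in> img B octagon" using B by simp
  moreover have "wall_at (wall_mat s l m) (teich_ray \<theta> t) > 0" if "m \<le> 7" for m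
    using interior_times[OF t(1,2) that] by (simp only: wall_at_ray_sign)
  ultimately obtain j d where "j \<le> 7" "d \<noteq> 0" "B = d *\<^sub>R (nu_mat j ** tile_mat s l)"
    using tile_interior_unique[OF tile_mat_veech B(1)] by blast
  then have T: "T = img (tile_mat s l) octagon"
    using B(2) by (simp add: img_scale img_nu_mult_octagon tile_mat_det)
  then have "{?a..c} = {?a..?b}" "?a < c" "?a < ?b"
    using assms tile_traversed[of l] by (simp_all add: traverses_def)
  then have "c = ?b" by (simp add: Icc_eq_Icc)
  with T show ?thesis by simp
qed

lemma tile_0: "img (tile_mat s 0) octagon = octagon"
  by (simp add: img_one)

lemma entry_time_simps: "entry_time \<theta> s 0 = 0" "entry_time \<theta> s (Suc l) = exit_time \<theta> s l"
  by (simp_all add: entry_time_def)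

lemma nth_tile_iff:
  "nth_tile (teich_ray \<theta>) l T a b \<longleftrightarrow>
    T = img (tile_mat s l) octagon \<and> a = entry_time \<theta> s l \<and> b = exit_time \<theta> s l"
proof
  assume "nth_tile (teich_ray \<theta>) l T a b"
  then show "T = img (tile_mat s l) octagon \<and> a = entry_time \<theta> s l \<and> b = exit_time \<theta> s l"
  proof induction
    case (zero b)
    then show ?case using traversed_unique[of octagon 0 b] by (simp only: tile_0 entry_time_simps)
  next
    case (Suc l T a b T' c)
    then show ?case using traversed_unique[of T' "Suc l" c] by (simp only: entry_time_simps)
  qed
next
  have "nth_tile (teich_ray \<theta>) l (img (tile_mat s l) octagon) (entry_time \<theta> s l) (exit_time \<theta> s l)"
  proof (induction l)
    case 0
    show ?case
      using tile_traversed[of 0] unfolding tile_0 entry_time_simps by (rule nth_tile.zero)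
  next
    case (Suc l)
    then show ?case
      using tile_traversed[of "Suc l"] unfolding entry_time_simps by (rule nth_tile.Suc)
  qed
  then show "T = img (tile_mat s l) octagon \<and> a = entry_time \<theta> s l \<and> b = exit_time \<theta> s l \<Longrightarrow>
      nth_tile (teich_ray \<theta>) l T a b" by simp
qed

lemma exit_point: "teich_ray \<theta> (exit_time \<theta> s l) \<in> img (tile_mat s l) (side (s l))"
  by (simp only: img_side_iff[OF tile_mat_det le7] wall_at_ray_sign along_exit Im_teich_ray_pos)

lemma entry_point: "teich_ray \<theta> (entry_time \<theta> s (Suc l)) \<in> img (tile_mat s (Suc l)) (side 0)"
proof -
  have "along \<theta> (wall_mat s (Suc l) 0) (entry_time \<theta> s (Suc l)) = 0"
    by (simp only: along_Suc_0 along_exit neg_equal_0_iff_equal entry_time_simps)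
  then show ?thesis
    using img_side_iff[OF tile_mat_det[of "Suc l"], of 0] Im_teich_ray_pos
    by (simp only: wall_at_ray_sign)
qed

text \<open>Since the sides of a tile are disjoint, the entry and exit sides are determined by the entry and exit
points. The normalizing element of the \<open>l\<close>-th tile is the inverse of \<open>tile_mat s l\<close>, which sends the
exit side to \<open>side (s l)\<close>.\<close>

lemma cutting_symbol_iff: "cutting_symbol (teich_ray \<theta>) l k \<longleftrightarrow> k = s l"
proof (cases l)
  case 0
  have unique: "k = s 0" if "k \<le> 7" "teich_ray \<theta> (exit_time \<theta> s 0) \<in> side k" for k
    using img_sides_disjoint[OF tile_mat_det[of 0] that(1) le7, of _ 0] exit_point[of 0] that(2)
    by (simp add: img_one)
  have "teich_ray \<theta> (exit_time \<theta> s 0) \<in> side (s 0)" using exit_point[of 0] by (simp add: img_one)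
  moreover have "cutting_symbol (teich_ray \<theta>) 0 k \<longleftrightarrow> k \<in> {0..7} \<and> teich_ray \<theta> (exit_time \<theta> s 0) \<in> side k"
    unfolding cutting_symbol_def nth_tile_iff tile_0 entry_time_simps by simp
  ultimately show ?thesis
    using unique[of k] le7[of 0] unfolding 0 by auto
next
  case (Suc m)
  let ?A = "tile_mat s l" and ?T = "img (tile_mat s l) octagon"
  have side_at: "E = img ?A (side i)" 
    if "is_side_of E ?T" "z \<in> E" "z \<in> img ?A (side i)" "i \<le> 7" for E i z
    using that img_sides_disjoint[OF tile_mat_det] unfolding is_side_of_img[OF tile_mat_veech] by blast
  have entry: "teich_ray \<theta> (entry_time \<theta> s l) \<in> img ?A side0"
    using entry_point[of m] unfolding Suc side_0 .
  have normalized: "proj_image (img ?A (side (s l))) (normalizing_elem ?T (img ?A side0)) = side (s l)"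
    using tile_mat_det[of l] le7[of l]
    by (simp add: normalizing_elem_img tile_mat_veech proj_image_class img_mult[OF side_upper] mult_adj2 img_scale img_one)
  have is_side: "is_side_of (img ?A (side i)) ?T" if "i \<le> 7" for i
    using that is_side_of_img[OF tile_mat_veech] by blast
  have inj: "k = s l" if "side (s l) = side k" "k \<le> 7" for k
    using img_side_inject[of "mat 1" "s l" k] le7 that by simp
  have "cutting_symbol (teich_ray \<theta>) l k \<longleftrightarrow> k \<in> {1..7} \<and> side (s l) = side k"
  proof
    assume "cutting_symbol (teich_ray \<theta>) l k"
    then obtain E E' where k: "k \<in> {1..7}" and E: "is_side_of E ?T" "teich_ray \<theta> (entry_time \<theta> s l) \<in> E"
        "is_side_of E' ?T" "teich_ray \<theta> (exit_time \<theta> s l) \<in> E'"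
        "proj_image E' (normalizing_elem ?T E) = side k"
      unfolding cutting_symbol_def nth_tile_iff using Suc by auto
    have "E = img ?A side0" using side_at[OF E(1,2), of 0] entry by (simp add: side_0)
    moreover have "E' = img ?A (side (s l))" using side_at[OF E(3,4) exit_point le7] .
    ultimately show "k \<in> {1..7} \<and> side (s l) = side k" using k E(5) normalized by simp
  next
    assume k: "k \<in> {1..7} \<and> side (s l) = side k"
    have "is_side_of (img ?A side0) ?T" using is_side[of 0] by (simp add: side_0)
    then show "cutting_symbol (teich_ray \<theta>) l k"
      unfolding cutting_symbol_def nth_tile_iff
      using Suc k entry exit_point[of l] is_side[OF le7[of l]] normalized by auto
  qed
  then show ?thesis using inj le7[of l] nonzero[of m] Suc by auto
qed

lemma normalized_cutting_sequence_itinerary: "normalized_cutting_sequence (teich_ray \<theta>) l = s l"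
  by (simp add: normalized_cutting_sequence_def cutting_symbol_iff)

end

section \<open>From the Farey expansion to the itinerary\<close>

text \<open>The point with homogeneous coordinates \<open>(x, y)\<close>. In these coordinates a matrix acts linearly, without
case distinctions at infinity.\<close>

definition rp1_point :: "real \<Rightarrow> real \<Rightarrow> rp1" where
  "rp1_point x y = (if y = 0 then Infty else Fin (x / y))"

lemma inv_slope_point: "inv_slope \<phi> = rp1_point (cos \<phi>) (sin \<phi>)"
  by (simp add: inv_slope_def rp1_point_def cot_def)

lemma moebius_point:
  assumes "det A \<noteq> 0" "x \<noteq> 0 \<or> y \<noteq> 0"
  shows "moebius A (rp1_point x y) = rp1_point (A$1$1 * x + A$1$2 * y) (A$2$1 * x + A$2$2 * y)"
proof (cases "y = 0")
  case True
  then show ?thesis using assms by (simp add: rp1_point_def)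
next
  case False
  have "A$2$1 * (x / y) + A$2$2 = (A$2$1 * x + A$2$2 * y) / y"
    "A$1$1 * (x / y) + A$1$2 = (A$1$1 * x + A$1$2 * y) / y"
    using False by (simp_all add: field_simps)
  then show ?thesis using False by (simp add: rp1_point_def)
qed

lemma image_point_nonzero:
  fixes A :: "real^2^2"
  assumes "det A \<noteq> 0" "x \<noteq> 0 \<or> y \<noteq> 0"
  shows "A$1$1 * x + A$1$2 * y \<noteq> 0 \<or> A$2$1 * x + A$2$2 * y \<noteq> 0"
proof (rule ccontr)
  assume "\<not> ?thesis"
  then have z: "A$1$1 * x + A$1$2 * y = 0" "A$2$1 * x + A$2$2 * y = 0" by auto
  have "det A * x = A$2$2 * (A$1$1 * x + A$1$2 * y) - A$1$2 * (A$2$1 * x + A$2$2 * y)"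
    "det A * y = A$1$1 * (A$2$1 * x + A$2$2 * y) - A$2$1 * (A$1$1 * x + A$1$2 * y)"
    unfolding det_2 by algebra+
  then show False using z assms by simp
qed

lemma rp1_point_eqD:
  assumes "rp1_point x y = rp1_point (cos \<phi>) (sin \<phi>)"
  shows "\<exists>r. x = r * cos \<phi> \<and> y = r * sin \<phi>"
proof (cases "sin \<phi> = 0")
  case True
  then have "cos \<phi> \<noteq> 0" using sin_cos_squared_add[of \<phi>] by auto
  then show ?thesis
    using assms True by (intro exI[of _ "x / cos \<phi>"]) (auto simp: rp1_point_def split: if_splits)
next
  case False
  then show ?thesis
    using assms by (intro exI[of _ "y / sin \<phi>"]) (auto simp: rp1_point_def field_simps split: if_splits)
qed

lemma inv_slope_angle_coord: "inv_slope (angle_coord u) = u"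
proof -
  have "\<exists>!\<phi>. 0 < \<phi> \<and> \<phi> \<le> pi \<and> inv_slope \<phi> = u"
  proof (rule ex_ex1I)
    show "\<exists>\<phi>. 0 < \<phi> \<and> \<phi> \<le> pi \<and> inv_slope \<phi> = u"
    proof (cases u)
      case (Fin x)
      have a: "- (pi / 2) < arctan x" "arctan x < pi / 2" using arctan_bounded by auto
      then have "sin (pi / 2 - arctan x) > 0" by (intro sin_gt_zero) auto
      moreover have "cot (pi / 2 - arctan x) = tan (arctan x)"
        unfolding cot_def tan_def cos_diff sin_diff by (simp only: cos_pi_half sin_pi_half) simp
      then have "cot (pi / 2 - arctan x) = x" by (simp only: tan_arctan)
      ultimately show ?thesis
        using a Fin by (intro exI[of _ "pi / 2 - arctan x"]) (auto simp: inv_slope_def)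
    next
      case Infty
      then show ?thesis by (intro exI[of _ pi]) (simp add: inv_slope_def)
    qed
    fix \<phi> \<psi> assume \<phi>: "0 < \<phi> \<and> \<phi> \<le> pi \<and> inv_slope \<phi> = u" and \<psi>: "0 < \<psi> \<and> \<psi> \<le> pi \<and> inv_slope \<psi> = u"
    then have "rp1_point (cos \<phi>) (sin \<phi>) = rp1_point (cos \<psi>) (sin \<psi>)"
      by (simp flip: inv_slope_point)
    then obtain r where "cos \<phi> = r * cos \<psi>" "sin \<phi> = r * sin \<psi>" using rp1_point_eqD by blast
    then have "sin (\<phi> - \<psi>) = 0" by (simp add: sin_diff)
    moreover have "- pi < \<phi> - \<psi>" "\<phi> - \<psi> < pi" using \<phi> \<psi> by linarith+
    ultimately show "\<phi> = \<psi>" using sin_eq_0_pi[of "\<phi> - \<psi>"] by simp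
  qed
  from theI'[OF this] show ?thesis unfolding angle_coord_def by blast
qed

primrec farey_orbit :: "(nat \<Rightarrow> nat) \<Rightarrow> real \<Rightarrow> nat \<Rightarrow> real" where
  "farey_orbit s \<theta> 0 = \<theta>"
| "farey_orbit s \<theta> (Suc l) = farey_branch (s l) (farey_orbit s \<theta> l)"

lemma farey_orbit_sector:
  assumes "octagon_expansion \<theta> s"
  shows "farey_orbit s \<theta> l \<in> sector (s l)"
proof -
  have start: "\<theta> \<in> farey_cylinder (map s [0..<Suc k])" for k
    using assms unfolding octagon_expansion_def by blast
  have "farey_orbit s \<theta> l \<in> farey_cylinder (map s [l..<l + Suc k])" for k
  proof (induction l arbitrary: k)
    case 0
    show ?case using start[of k] by (simp del: upt_Suc)
  next
    case (Suc l)
    have "map s [l..<l + Suc (Suc k)] = s l # map s [Suc l..<Suc l + Suc k]"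
      by (subst upt_conv_Cons) (simp_all del: upt_Suc)
    with Suc.IH[of "Suc k"] show ?case by (simp del: upt_Suc)
  qed
  from this[of 0] show ?thesis by simp
qed

lemma farey_orbit_point:
  assumes "\<And>l. s l \<le> 7"
  shows "inv_slope (farey_orbit s \<theta> l) =
    rp1_point (tile_mat s l$1$1 * cos \<theta> + tile_mat s l$1$2 * sin \<theta>)
              (tile_mat s l$2$1 * cos \<theta> + tile_mat s l$2$2 * sin \<theta>)"
proof (induction l)
  case 0
  show ?case by (simp add: inv_slope_point)
next
  case (Suc l)
  have cs: "cos \<theta> \<noteq> 0 \<or> sin \<theta> \<noteq> 0" using sin_zero_abs_cos_one[of \<theta>] by auto
  have det: "det (tile_mat s l) \<noteq> 0"
    by (induction l) (simp_all add: det_mul det_nu_nonzero assms)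
  have det': "det (gamma_mat ** nu_mat (s l)) \<noteq> 0"
    by (simp add: det_mul det_nu_nonzero assms)
  show ?case
    unfolding farey_orbit.simps farey_branch_def inv_slope_angle_coord Suc
      moebius_point[OF det' image_point_nonzero[OF det cs]]
    by (simp add: algebra_simps)
qed

lemma sin_cos_pi8: "sin (pi / 8) = (sqrt 2 - 1) * cos (pi / 8)"
proof -
  let ?S = "sin (pi / 8)" and ?C = "cos (pi / 8)"
  have pos: "?S > 0" "?C > 0" by (intro sin_gt_zero cos_gt_zero; simp)+
  have "2 * ?S * ?C = ?C\<^sup>2 - ?S\<^sup>2"
    using sin_double[of "pi / 8"] cos_double[of "pi / 8"] by (simp add: sin_45 cos_45 mult_ac)
  then have "(?S + ?C)\<^sup>2 = 2 * ?C\<^sup>2" by (simp add: power2_eq_square algebra_simps)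
  then have "(?S + ?C)\<^sup>2 = (sqrt 2 * ?C)\<^sup>2" by (simp add: power_mult_distrib)
  then have "?S + ?C = sqrt 2 * ?C"
    by (rule power2_eq_imp_eq) (use pos in simp_all)
  then show ?thesis by (simp add: algebra_simps)
qed

text \<open>Each \<open>\<nu>\<^sub>i\<close> carries the \<open>i\<close>-th sector isometrically onto the sector \<open>[0, \<pi>/8]\<close>: by a rotation for even \<open>i\<close>
and by a reflection for odd \<open>i\<close>.\<close>

lemma sector_rotated:
  assumes "i \<le> 7" "\<phi> \<in> sector i"
  shows "\<exists>\<psi>. 0 \<le> \<psi> \<and> \<psi> \<le> pi / 8 \<and>
    nu_mat i$1$1 * cos \<phi> + nu_mat i$1$2 * sin \<phi> = cos \<psi> \<and>
    nu_mat i$2$1 * cos \<phi> + nu_mat i$2$2 * sin \<phi> = sin \<psi>"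
proof -
  \<comment> \<open>The angle measured from the edge of the sector that is mapped to the horizontal direction.\<close>
  define \<psi> where "\<psi> = (if even i then \<phi> - real i * pi / 8 else real (i + 1) * pi / 8 - \<phi>)"
  have sq: "1 / sqrt 2 = sqrt 2 / (2::real)" by (simp add: field_simps)
  have 3: "cos (3 * pi / 4) = - sqrt 2 / 2" "sin (3 * pi / 4) = sqrt 2 / 2"
    using cos_pi_minus[of "pi / 4"] sin_pi_minus[of "pi / 4"] by (simp_all add: sin_45 cos_45)
  have "nu_mat i$1$1 * cos \<phi> + nu_mat i$1$2 * sin \<phi> = cos \<psi> \<and>
    nu_mat i$2$1 * cos \<phi> + nu_mat i$2$2 * sin \<phi> = sin \<psi>"
    using assms(1)
    by (rule le_7_cases)
      (simp_all add: \<psi>_def nu_mat_def sq cos_diff sin_diff sin_45 cos_45 3 3[unfolded mult.commute[of 3]] mult_ac)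
  moreover have "0 \<le> \<psi>" "\<psi> \<le> pi / 8"
    using assms(2) by (auto simp: \<psi>_def sector_def field_simps)
  ultimately show ?thesis by blast
qed

text \<open>Rotating by a right angle exchanges the direction \<open>(cos \<theta>, sin \<theta>)\<close> with the row vector of the forward
endpoint, and the left action of \<open>B\<close> on the one with the right action of the adjugate on the other.\<close>

lemma fwd_adj2:
  "fwd \<theta> (adj2 B) =
    (B$2$1 * cos \<theta> + B$2$2 * sin \<theta>) *
    ((B$2$1 * cos \<theta> + B$2$2 * sin \<theta>) - (sqrt 2 - 1) * (B$1$1 * cos \<theta> + B$1$2 * sin \<theta>))"
  unfolding fwd_def wall_form_row by (simp add: algebra_simps)

text \<open>After applying \<open>tile_mat s l\<close> and \<open>\<nu>\<^bsub>s l\<^esub>\<close>, the direction is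
spanned by \<open>(cos \<psi>, sin \<psi>)\<close> with \<open>\<psi>\<close> in \<open>[0, \<pi>/8]\<close>, where \<open>0 \<le> tan \<psi> \<le> \<surd>2 - 1\<close>.\<close>

lemma fwd_expansion_nonpos:
  assumes "octagon_expansion \<theta> s"
  shows "fwd \<theta> (wall_mat s l (s l)) \<le> 0"
proof -
  have le: "s l \<le> 7" for l using assms by (auto simp: octagon_expansion_def)
  let ?A = "tile_mat s l" and ?N = "nu_mat (s l)" and ?\<phi> = "farey_orbit s \<theta> l"
  define x where "x = ?A$1$1 * cos \<theta> + ?A$1$2 * sin \<theta>"
  define y where "y = ?A$2$1 * cos \<theta> + ?A$2$2 * sin \<theta>"
  have "rp1_point x y = rp1_point (cos ?\<phi>) (sin ?\<phi>)"
    using farey_orbit_point[of s, OF le, where \<theta> = \<theta> and l = l] by (simp add: inv_slope_point x_def y_def)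
  then obtain r where r: "x = r * cos ?\<phi>" "y = r * sin ?\<phi>" using rp1_point_eqD by blast
  obtain \<psi> where \<psi>: "0 \<le> \<psi>" "\<psi> \<le> pi / 8"
    "?N$1$1 * cos ?\<phi> + ?N$1$2 * sin ?\<phi> = cos \<psi>" "?N$2$1 * cos ?\<phi> + ?N$2$2 * sin ?\<phi> = sin \<psi>"
    using sector_rotated[OF le farey_orbit_sector[OF assms]] by blast
  have x': "(?N ** ?A)$1$1 * cos \<theta> + (?N ** ?A)$1$2 * sin \<theta> = r * cos \<psi>"
    and y': "(?N ** ?A)$2$1 * cos \<theta> + (?N ** ?A)$2$2 * sin \<theta> = r * sin \<psi>"
  proof -
    have "(?N ** ?A)$1$1 * cos \<theta> + (?N ** ?A)$1$2 * sin \<theta> = ?N$1$1 * x + ?N$1$2 * y"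
      "(?N ** ?A)$2$1 * cos \<theta> + (?N ** ?A)$2$2 * sin \<theta> = ?N$2$1 * x + ?N$2$2 * y"
      by (simp_all add: x_def y_def algebra_simps)
    then show "(?N ** ?A)$1$1 * cos \<theta> + (?N ** ?A)$1$2 * sin \<theta> = r * cos \<psi>"
      "(?N ** ?A)$2$1 * cos \<theta> + (?N ** ?A)$2$2 * sin \<theta> = r * sin \<psi>"
      unfolding r \<psi>(3,4)[symmetric] by (simp_all add: algebra_simps)
  qed
  have "fwd \<theta> (wall_mat s l (s l)) = r * sin \<psi> * (r * sin \<psi> - (sqrt 2 - 1) * (r * cos \<psi>))"
    unfolding adj2_mult[symmetric] fwd_adj2 x' y' ..
  also have "\<dots> = r\<^sup>2 * (sin \<psi> * (sin \<psi> - (sqrt 2 - 1) * cos \<psi>))"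
    by (simp add: power2_eq_square algebra_simps)
  also have "\<dots> \<le> 0"
  proof (intro mult_nonneg_nonpos)
    show "sin \<psi> \<ge> 0" using \<psi> by (intro sin_ge_zero) auto
    have "sin (pi / 8 - \<psi>) \<ge> 0" using \<psi> by (intro sin_ge_zero) auto
    then have "cos (pi / 8) * ((sqrt 2 - 1) * cos \<psi> - sin \<psi>) \<ge> 0"
      by (simp add: sin_diff sin_cos_pi8 algebra_simps)
    moreover have "cos (pi / 8) > 0" by (intro cos_gt_zero) auto
    ultimately show "sin \<psi> - (sqrt 2 - 1) * cos \<psi> \<le> 0"
      by (simp add: zero_le_mult_iff)
  qed simp
  finally show ?thesis .
qed

lemma transpose_nth: "transpose A$i$j = A$j$i"
  by (simp add: transpose_def)

text \<open>The form of \<open>side0\<close> vanishes on the boundary only at the endpoints \<open>0\<close> and \<open>1 - \<surd>2\<close> of \<open>side0\<close>, so the forward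
endpoint is the image of one of these under \<open>\<nu>\<^sub>i A\<close>.\<close>

lemma fwd_eq_0_imp_cuspidal:
  assumes "A \<in> veech" "i \<le> 7" "fwd \<theta> (adj2 A ** adj2 (nu_mat i)) = 0"
  shows "cuspidal \<theta>"
proof -
  let ?N = "nu_mat i"
  define B where "B = ?N ** A"
  have det: "det A \<noteq> 0" "det ?N \<noteq> 0" "det B \<noteq> 0"
    using assms by (simp_all add: B_def veech_det det_nu_nonzero det_mul)
  have cs: "cos \<theta> \<noteq> 0 \<or> sin \<theta> \<noteq> 0" using sin_zero_abs_cos_one[of \<theta>] by auto
  define x where "x = B$1$1 * cos \<theta> + B$1$2 * sin \<theta>"
  define y where "y = B$2$1 * cos \<theta> + B$2$2 * sin \<theta>"
  have xy: "x \<noteq> 0 \<or> y \<noteq> 0" unfolding x_def y_def using image_point_nonzero[OF det(3) cs] .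
  have "y * (y - (sqrt 2 - 1) * x) = 0"
    using assms(3) unfolding adj2_mult[symmetric] fwd_adj2 x_def y_def B_def .
  then have "y = 0 \<or> y = (sqrt 2 - 1) * x" by simp
  then have v0: "rp1_point y (- x) \<in> {Fin 0, Fin (1 - sqrt 2)}"
    using xy by (auto simp: rp1_point_def field_simps)
  define v where "v = right_act_bdry (rp1_point y (- x)) ?N"
  have v: "v \<in> octagon_vertices"
    using v0 assms(2) unfolding v_def octagon_vertices_def by auto
  have cusp: "proj_act_bdry v (proj_class A) \<in> ideal_vertices"
    using v assms(1) unfolding ideal_vertices_def veech_def by blast
  have yx: "y \<noteq> 0 \<or> - x \<noteq> 0" using xy by auto
  have "proj_act_bdry v (proj_class A) = moebius (transpose A) (moebius (transpose ?N) (rp1_point y (- x)))"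
    using det by (simp add: proj_act_bdry_class right_act_bdry_def v_def)
  also have "\<dots> = rp1_point (B$1$1 * y - B$2$1 * x) (B$1$2 * y - B$2$2 * x)"
    using det image_point_nonzero[of "transpose ?N", OF _ yx] yx
    by (simp add: moebius_point transpose_nth det_transpose B_def algebra_simps)
  also have "\<dots> = rp1_point (det B * sin \<theta>) (- det B * cos \<theta>)"
    unfolding x_def y_def det_2 by (simp add: algebra_simps)
  also have "\<dots> = (if cos \<theta> = 0 then Infty else Fin (- tan \<theta>))"
    using det(3) by (simp add: rp1_point_def tan_def)
  finally show ?thesis
    using cusp teich_ray_endpoint[of \<theta>] unfolding cuspidal_def by metis
qed

lemma expansion_itinerary:
  assumes "\<not> cuspidal \<theta>" "octagon_expansion \<theta> s"
  shows "itinerary \<theta> s"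
proof -
  have le: "s l \<le> 7" for l using assms(2) by (auto simp: octagon_expansion_def)
  have veech: "tile_mat s l \<in> veech" for l
    by (induction l) (simp_all add: veech_one veech_mult veech_generators veech_nu le)
  have "fwd \<theta> (wall_mat s l (s l)) < 0" for l
    using fwd_expansion_nonpos[OF assms(2), of l] fwd_eq_0_imp_cuspidal[OF veech le] assms(1)
    by (metis order_le_less)
  moreover have "s (Suc l) \<noteq> 0" for l using assms(2) by (simp add: octagon_expansion_def)
  ultimately show ?thesis using le by (simp add: itinerary_def)
qed

theorem proposition3p10:
  fixes \<theta> :: real and s :: "nat \<Rightarrow> nat"
  assumes "\<not> cuspidal \<theta>"
    and "octagon_expansion \<theta> s"
  shows "\<forall>k. normalized_cutting_sequence (teich_ray \<theta>) k = s k"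
  using normalized_cutting_sequence_itinerary[OF expansion_itinerary[OF assms]] by blast

end
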